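(* There is a compact set $K\subset\mathbb{R}$ such that $\dim_H K=\dim_P K=1$ and the set $$\{f\in C(K,\mathbb{R}): \dim_H f^{-1}(y)\leq\dim_P f^{-1}(y)<1\text{ for all }y\in\mathbb{R}\}$$ is non-shy in $C(K,\mathbb{R})$.
   Context: Shyness: for an abelian Polish group $G$, a set $A\subset G$ is shy if there exist a Borel set $B\supset A$ in $G$ and a Borel probability measure $\nu$ on $G$ with $\nu(B+x)=0$ for all $x\in G$; non-shy means not shy. $C(K,\mathbb{R})$ is the Banach space of continuous functions $K\to\mathbb{R}$ with the maximum norm (an abelian Polish group under addition). Dimensions: $\dim_H$ is Hausdorff dimension, with $\dim_H\emptyset=-1$. For a non-empty totally bounded metric space $X$, $N_\delta(X)$ is the smallest number of closed balls of radius $\delta$ covering $X$, and $\overline{\dim}_B X=\limsup_{\delta\to0+}\log N_\delta(X)/\log(1/\delta)$; $\overline{\dim}_B\emptyset=-1$ and $\overline{\dim}_B X=\infty$ if $X$ is not totally bounded. $\dim_P X=\inf\{\sup_i\overline{\dim}_B X_i: X=\bigcup_{i=1}^\infty X_i\}$ (so $\dim_P\emptyset=-1$). *)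

theory Defs
  imports "HOL-Analysis.Analysis" "HOL-Probability.Probability" "HOL-Algebra.Group"
begin

section \<open>Abelian Polish groups and shy sets\<close>

locale abelian_polish_group = comm_group G for G (structure) +
  fixes T :: "'a topology"
  assumes topspace_eq: "topspace T = carrier G"
    and continuous_mult:
      "continuous_map (prod_topology T T) T (\<lambda>(x, y). x \<otimes>\<^bsub>G\<^esub> y)"
    and continuous_inv: "continuous_map T T (\<lambda>x. inv\<^bsub>G\<^esub> x)"
    and completely_metrizable: "completely_metrizable_space T"
    and separable: "separable_space T"

definition borel_of :: "'a topology \<Rightarrow> 'a measure" where
  "borel_of T = sigma (topspace T) {U. openin T U}"

text \<open>
  Membership in \<^const>\<open>null_sets\<close> says that the translate is measurable and has measure zero;
  \<^const>\<open>emeasure\<close> alone would also be zero on sets that are not measurable.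
\<close>

definition shy :: "('a, 'b) monoid_scheme \<Rightarrow> 'a topology \<Rightarrow> 'a set \<Rightarrow> bool" where
  "shy G T A \<longleftrightarrow>
    (\<exists>B \<nu>. B \<in> sets (borel_of T) \<and> A \<subseteq> B \<and>
      prob_space \<nu> \<and> sets \<nu> = sets (borel_of T) \<and>
      (\<forall>x \<in> carrier G. (\<lambda>b. b \<otimes>\<^bsub>G\<^esub> x) ` B \<in> null_sets \<nu>))"


section \<open>The additive group of continuous real functions on a compact set\<close>

text \<open>
  The elements of \<open>C(K)\<close> are functions that take the value \<^const>\<open>undefined\<close> outside \<open>K\<close>, and the
  distance is the supremum of \<open>\<bar>f x - g x\<bar>\<close> over \<open>x \<in> K\<close> (zero if \<open>K\<close> is empty).
\<close>

definition C_metric :: "'a::metric_space set \<Rightarrow> ('a \<Rightarrow> real) metric" where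
  "C_metric K = cfunspace (top_of_set K) euclidean_metric"

definition C_group :: "'a::metric_space set \<Rightarrow> ('a \<Rightarrow> real) monoid" where
  "C_group K =
    \<lparr>carrier = mspace (C_metric K),
     mult = (\<lambda>f g. \<lambda>x\<in>K. f x + g x),
     one = (\<lambda>x\<in>K. 0)\<rparr>"

lemma carrier_C_group:
  assumes "compact K"
  shows "carrier (C_group K) = {f \<in> extensional K. continuous_on K f}"
proof -
  have "compactin (top_of_set K) (topspace (top_of_set K))"
    using assms by (simp add: compactin_subtopology)
  from compactin_mspace_cfunspace[OF this, of "euclidean_metric :: real metric"]
  show ?thesis
    by (auto simp: C_group_def C_metric_def simp del: mspace_cfunspace)
qed

lemma mult_C_group: "f \<otimes>\<^bsub>C_group K\<^esub> g = (\<lambda>x\<in>K. f x + g x)"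
  by (simp add: C_group_def)

lemma one_C_group: "\<one>\<^bsub>C_group K\<^esub> = (\<lambda>x\<in>K. 0)"
  by (simp add: C_group_def)

lemma mdist_C_metric:
  assumes "f \<in> carrier (C_group K)" "g \<in> carrier (C_group K)"
  shows "mdist (C_metric K) f g = (if K = {} then 0 else SUP x\<in>K. \<bar>f x - g x\<bar>)"
proof -
  have "f \<in> mspace (funspace K (euclidean_metric :: real metric))"
       "g \<in> mspace (funspace K (euclidean_metric :: real metric))"
    using assms cfunspace_subset_funspace[of "top_of_set K" "euclidean_metric :: real metric"]
    by (auto simp: C_group_def C_metric_def simp del: mspace_cfunspace mspace_funspace)
  then show ?thesis
    by (simp add: C_metric_def mdist_cfunspace_eq_mdist_funspace Met_TC.fdist_def dist_real_def)
qed

lemma mdist_C_metric_le: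
  assumes "0 \<le> e" "\<And>x. x \<in> K \<Longrightarrow> \<bar>f x - g x\<bar> \<le> e"
  shows "mdist (C_metric K) f g \<le> e"
  unfolding C_metric_def using assms
  by (intro mdist_cfunspace_le) (auto simp: dist_real_def)

lemma mdist_C_metric_ge:
  assumes "f \<in> carrier (C_group K)" "g \<in> carrier (C_group K)" "x \<in> K"
  shows "\<bar>f x - g x\<bar> \<le> mdist (C_metric K) f g"
  using assms mdist_cfunspace_imp_mdist_le[of f "top_of_set K" euclidean_metric g _ x]
  by (auto simp: C_group_def C_metric_def dist_real_def simp del: mspace_cfunspace)

lemma comm_group_C_group:
  assumes "compact K"
  shows "comm_group (C_group K)"
proof (rule comm_groupI)
  fix f assume f: "f \<in> carrier (C_group K)"
  show "\<exists>g\<in>carrier (C_group K). g \<otimes>\<^bsub>C_group K\<^esub> f = \<one>\<^bsub>C_group K\<^esub>"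
    using f unfolding carrier_C_group[OF assms]
    by (intro bexI[of _ "\<lambda>x\<in>K. - f x"])
       (auto simp: mult_C_group one_C_group fun_eq_iff intro!: continuous_intros
             cong: continuous_on_cong)
qed (auto simp: carrier_C_group[OF assms] fun_eq_iff extensional_def mult_C_group one_C_group
       intro!: continuous_intros cong: continuous_on_cong)

lemma inv_C_group:
  assumes "compact K" "f \<in> carrier (C_group K)"
  shows "inv\<^bsub>C_group K\<^esub> f = (\<lambda>x\<in>K. - f x)"
proof -
  interpret comm_group "C_group K"
    using assms(1) by (rule comm_group_C_group)
  show ?thesis
  proof (rule inv_equality)
    show "(\<lambda>x\<in>K. - f x) \<in> carrier (C_group K)"
      using assms(2) unfolding carrier_C_group[OF assms(1)]
      by (auto intro!: continuous_intros cong: continuous_on_cong)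
    show "(\<lambda>x\<in>K. - f x) \<otimes>\<^bsub>C_group K\<^esub> f = \<one>\<^bsub>C_group K\<^esub>"
      by (auto simp: mult_C_group one_C_group fun_eq_iff)
  qed (fact assms(2))
qed

lemma separable_space_C_metric:
  fixes K :: "real set"
  assumes "compact K"
  shows "separable_space (mtopology_of (C_metric K))"
proof -
  interpret M: Metric_space "mspace (C_metric K)" "mdist (C_metric K)"
    by simp
  define p :: "rat list \<Rightarrow> real \<Rightarrow> real"
    where "p cs = (\<lambda>x\<in>K. \<Sum>i<length cs. of_rat (cs ! i) * x ^ i)" for cs
  have mspace: "mspace (C_metric K) = {f \<in> extensional K. continuous_on K f}"
    using carrier_C_group[OF assms] by (simp add: C_group_def)
  have range: "range p \<subseteq> mspace (C_metric K)"
    unfolding mspace by (auto simp: p_def intro!: continuous_intros cong: continuous_on_cong)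
  have dense: "\<exists>g\<in>range p. g \<in> M.mcball f r"
    if f: "f \<in> mspace (C_metric K)" and r: "r > 0" for f r
  proof -
    have cont: "continuous_on K f"
      using f unfolding mspace by blast
    obtain q where q: "real_polynomial_function q" "\<And>x. x \<in> K \<Longrightarrow> \<bar>f x - q x\<bar> < r / 2"
      using Stone_Weierstrass_real_polynomial_function[OF assms cont, of "r / 2"] r by auto
    obtain a n where q_eq: "q = (\<lambda>x. \<Sum>i\<le>n. a i * x ^ i)"
      using q(1) unfolding real_polynomial_function_iff_sum by blast
    obtain B where B: "B > 0" "\<And>x. x \<in> K \<Longrightarrow> \<bar>x\<bar> \<le> B"
      using compact_imp_bounded[OF assms] unfolding bounded_pos by auto
    define e where "e = r / (2 * (\<Sum>i\<le>n. B ^ i))"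
    have S_pos: "(\<Sum>i\<le>n. B ^ i) > 0"
      using B(1) by (intro sum_pos) auto
    then have e: "e > 0"
      using r by (simp add: e_def)
    have "\<exists>c::rat. \<bar>a i - of_rat c\<bar> \<le> e" for i
    proof -
      obtain c where "a i - e < of_rat c" "of_rat c < a i"
        using of_rat_dense[of "a i - e" "a i"] e by auto
      then show ?thesis
        by (intro exI[of _ c]) auto
    qed
    then obtain c :: "nat \<Rightarrow> rat" where c: "\<And>i. \<bar>a i - of_rat (c i)\<bar> \<le> e"
      by metis
    define cs where "cs = map c [0..<Suc n]"
    have p_eq: "p cs x = (\<Sum>i\<le>n. of_rat (c i) * x ^ i)" if "x \<in> K" for x
    proof -
      have "p cs x = (\<Sum>i<Suc n. of_rat (cs ! i) * x ^ i)"
        using that by (simp add: p_def cs_def)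
      also have "\<dots> = (\<Sum>i<Suc n. of_rat (c i) * x ^ i)"
        by (intro sum.cong refl) (auto simp: cs_def simp del: upt_Suc)
      finally show ?thesis
        by (simp add: lessThan_Suc_atMost)
    qed
    have "\<bar>f x - p cs x\<bar> \<le> r" if x: "x \<in> K" for x
    proof -
      have "\<bar>q x - p cs x\<bar> = \<bar>\<Sum>i\<le>n. (a i - of_rat (c i)) * x ^ i\<bar>"
        by (simp add: q_eq p_eq[OF x] sum_subtractf left_diff_distrib)
      also have "\<dots> \<le> (\<Sum>i\<le>n. \<bar>(a i - of_rat (c i)) * x ^ i\<bar>)"
        by (rule sum_abs)
      also have "\<dots> \<le> (\<Sum>i\<le>n. e * B ^ i)"
        using c B(2)[OF x] e
        by (intro sum_mono) (auto simp: abs_mult power_abs intro!: mult_mono power_mono)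
      also have "\<dots> = e * (\<Sum>i\<le>n. B ^ i)"
        by (rule sum_distrib_left[symmetric])
      also have "\<dots> = r / 2"
        using S_pos by (simp add: e_def)
      finally show ?thesis
        using q(2)[OF x] by linarith
    qed
    then have "mdist (C_metric K) f (p cs) \<le> r"
      using r by (intro mdist_C_metric_le) auto
    then show ?thesis
      using f range by (intro bexI[of _ "p cs"]) auto
  qed
  show ?thesis
    unfolding separable_space_def
  proof (intro exI conjI)
    show "countable (range p)"
      by simp
    show "range p \<subseteq> topspace (mtopology_of (C_metric K))"
      using range by simp
    show "mtopology_of (C_metric K) closure_of range p = topspace (mtopology_of (C_metric K))"
      using dense unfolding mtopology_of_def M.metric_closure_of_alt by auto
  qed
qed

lemma abelian_polish_group_C:
  fixes K :: "real set"
  assumes "compact K"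
  shows "abelian_polish_group (C_group K) (mtopology_of (C_metric K))"
proof -
  interpret comm_group "C_group K"
    using assms by (rule comm_group_C_group)
  let ?M = "C_metric K"
  have carrier: "carrier (C_group K) = mspace ?M"
    by (simp add: C_group_def)
  show ?thesis
  proof
    show "topspace (mtopology_of ?M) = carrier (C_group K)"
      by (simp add: carrier)
    have "Lipschitz_continuous_map (prod_metric ?M ?M) ?M (\<lambda>(f, g). f \<otimes>\<^bsub>C_group K\<^esub> g)"
      unfolding Lipschitz_continuous_map_def
    proof (intro conjI exI[of _ 2] ballI)
      show "(\<lambda>(f, g). f \<otimes>\<^bsub>C_group K\<^esub> g) \<in> mspace (prod_metric ?M ?M) \<rightarrow> mspace ?M"
        using m_closed by (auto simp: carrier)
      fix u v assume "u \<in> mspace (prod_metric ?M ?M)" "v \<in> mspace (prod_metric ?M ?M)"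
      then obtain f g f' g' where
        uv: "u = (f, g)" "v = (f', g')" and
        in_C: "f \<in> carrier (C_group K)" "g \<in> carrier (C_group K)"
              "f' \<in> carrier (C_group K)" "g' \<in> carrier (C_group K)"
        by (auto simp: carrier)
      let ?d = "mdist (prod_metric ?M ?M) u v"
      have le: "mdist ?M f f' \<le> ?d" "mdist ?M g g' \<le> ?d"
        using Metric_space12.component_le_prod_metric[OF Metric_space12_mspace_mdist, of ?M]
        by (auto simp: uv)
      have "?d \<ge> 0"
        by (rule mdist_nonneg)
      have "mdist ?M (f \<otimes>\<^bsub>C_group K\<^esub> g) (f' \<otimes>\<^bsub>C_group K\<^esub> g') \<le> 2 * ?d"
      proof (rule mdist_C_metric_le)
        fix x assume x: "x \<in> K"
        have "\<bar>f x - f' x\<bar> \<le> ?d" "\<bar>g x - g' x\<bar> \<le> ?d"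
          using mdist_C_metric_ge[OF in_C(1,3) x] mdist_C_metric_ge[OF in_C(2,4) x] le
          by linarith+
        then show "\<bar>(f \<otimes>\<^bsub>C_group K\<^esub> g) x - (f' \<otimes>\<^bsub>C_group K\<^esub> g') x\<bar> \<le> 2 * ?d"
          using x by (simp add: mult_C_group del: mdist_prod_metric)
      qed (use \<open>?d \<ge> 0\<close> in simp)
      then show "mdist ?M (case u of (f, g) \<Rightarrow> f \<otimes>\<^bsub>C_group K\<^esub> g)
          (case v of (f, g) \<Rightarrow> f \<otimes>\<^bsub>C_group K\<^esub> g) \<le> 2 * ?d"
        by (simp add: uv)
    qed
    from Lipschitz_continuous_imp_continuous_map[OF this]
    show "continuous_map (prod_topology (mtopology_of ?M) (mtopology_of ?M)) (mtopology_of ?M)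
        (\<lambda>(f, g). f \<otimes>\<^bsub>C_group K\<^esub> g)"
      by simp
    have "Lipschitz_continuous_map ?M ?M (\<lambda>f. inv\<^bsub>C_group K\<^esub> f)"
      unfolding Lipschitz_continuous_map_def
    proof (intro conjI exI[of _ 1] ballI)
      show "(\<lambda>f. inv\<^bsub>C_group K\<^esub> f) \<in> mspace ?M \<rightarrow> mspace ?M"
        using inv_closed by (auto simp: carrier)
      fix f g assume "f \<in> mspace ?M" "g \<in> mspace ?M"
      then have in_C: "f \<in> carrier (C_group K)" "g \<in> carrier (C_group K)"
        by (simp_all add: carrier)
      have "mdist ?M (inv\<^bsub>C_group K\<^esub> f) (inv\<^bsub>C_group K\<^esub> g) \<le> mdist ?M f g"
      proof (rule mdist_C_metric_le)
        fix x assume x: "x \<in> K"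
        then show "\<bar>(inv\<^bsub>C_group K\<^esub> f) x - (inv\<^bsub>C_group K\<^esub> g) x\<bar> \<le> mdist ?M f g"
          using mdist_C_metric_ge[OF in_C x]
          by (simp add: inv_C_group[OF assms] in_C)
      qed simp
      then show "mdist ?M (inv\<^bsub>C_group K\<^esub> f) (inv\<^bsub>C_group K\<^esub> g) \<le> 1 * mdist ?M f g"
        by simp
    qed
    then show "continuous_map (mtopology_of ?M) (mtopology_of ?M) (\<lambda>f. inv\<^bsub>C_group K\<^esub> f)"
      by (rule Lipschitz_continuous_imp_continuous_map)
    have "mcomplete_of (cfunspace (top_of_set K) (Met_TC.Self :: real metric))"
      by (rule Met_TC.mcomplete_cfunspace) (simp add: complete_UNIV)
    then have "mcomplete_of ?M"
      by (simp add: C_metric_def euclidean_metric_def Met_TC.Self_def)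
    then show "completely_metrizable_space (mtopology_of ?M)"
      unfolding completely_metrizable_space_def mcomplete_of_def mtopology_of_def
      by (metis Metric_space_mspace_mdist)
    show "separable_space (mtopology_of ?M)"
      using assms by (rule separable_space_C_metric)
  qed
qed


section \<open>Hausdorff, upper box and packing dimension\<close>

text \<open>
  The cases \<open>U = {}\<close> and \<open>s = 0\<close> implement the convention \<open>0\<^sup>0 = 1\<close> for the diameter of a
  nonempty set, whereas \<open>0 powr 0 = 0\<close>.
\<close>

definition diam_pow :: "real \<Rightarrow> 'a::metric_space set \<Rightarrow> ennreal" where
  "diam_pow s U = (if U = {} then 0 else if s = 0 then 1 else ennreal (diameter U powr s))"

text \<open>Boundedness is required because \<^const>\<open>diameter\<close> is meaningless on unbounded sets.\<close>

definition hausdorff_premeasure :: "real \<Rightarrow> real \<Rightarrow> 'a::metric_space set \<Rightarrow> ennreal" where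
  "hausdorff_premeasure s \<delta> A =
    Inf {(\<Sum>i. diam_pow s (U i)) | U :: nat \<Rightarrow> 'a set.
           A \<subseteq> (\<Union>i. U i) \<and> (\<forall>i. bounded (U i) \<and> diameter (U i) \<le> \<delta>)}"

definition hausdorff_measure :: "real \<Rightarrow> 'a::metric_space set \<Rightarrow> ennreal" where
  "hausdorff_measure s A = (SUP \<delta>\<in>{0<..}. hausdorff_premeasure s \<delta> A)"

definition hausdorff_dim :: "'a::metric_space set \<Rightarrow> ereal" where
  "hausdorff_dim A =
    (if A = {} then - 1 else Inf {ereal s | s. 0 \<le> s \<and> hausdorff_measure s A = 0})"

definition covering_number :: "real \<Rightarrow> 'a::metric_space set \<Rightarrow> nat" where
  "covering_number \<delta> X =
    (LEAST n. \<exists>C. finite C \<and> card C = n \<and> C \<subseteq> X \<and> X \<subseteq> (\<Union>c\<in>C. cball c \<delta>))"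

definition upper_box_dim :: "'a::metric_space set \<Rightarrow> ereal" where
  "upper_box_dim X =
    (if X = {} then - 1
     else if \<not> totally_bounded X then \<infinity>
     else Limsup (at_right 0) (\<lambda>\<delta>. ereal (ln (real (covering_number \<delta> X)) / ln (1 / \<delta>))))"

definition packing_dim :: "'a::metric_space set \<Rightarrow> ereal" where
  "packing_dim X =
    Inf {(SUP i. upper_box_dim (F i)) | F :: nat \<Rightarrow> 'a set. X = (\<Union>i. F i)}"

lemma hausdorff_dim_empty: "hausdorff_dim {} = - 1"
  by (simp add: hausdorff_dim_def)

lemma packing_dim_empty: "packing_dim ({} :: 'a::metric_space set) = - 1"
proof -
  have "{(SUP i. upper_box_dim (F i)) | F :: nat \<Rightarrow> 'a set. {} = (\<Union>i. F i)} = {- 1}"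
    by (auto simp: upper_box_dim_def intro!: exI[of _ "\<lambda>_. {}"])
  then show ?thesis
    by (simp add: packing_dim_def)
qed

end

theory Submission
  imports Defs "HOL-Real_Asymp.Real_Asymp"
begin

text \<open>
  Let \<open>K\<close> be the union of Cantor sets \<open>K\<^sub>n \<subseteq> [0, 2\<^sup>-\<^sup>n]\<close> that contain \<open>0\<close> and whose dimensions are
  below \<open>1\<close> but tend to \<open>1\<close>. If the level set of a function \<open>h\<close> at height \<open>h 0\<close> has no points other
  than \<open>0\<close> in some neighbourhood of \<open>0\<close>, then by continuity no level set of \<open>h\<close> accumulates at \<open>0\<close>
  and each of them lies in finitely many \<open>K\<^sub>n\<close>, hence has packing dimension below \<open>1\<close>.

  Given a Borel probability measure on \<open>C(K)\<close>, an Egorov argument yields a set \<open>F\<close> of positive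
  measure that is equicontinuous at \<open>0\<close>. A continuous \<open>g\<close> with \<open>g 0 = 0\<close> that grows faster near \<open>0\<close>
  than the common modulus of continuity of \<open>F\<close> gives \<open>(f + g) x > (f + g) 0\<close> for all \<open>f \<in> F\<close> and all
  small \<open>x > 0\<close> in \<open>K\<close>. So a translate of \<open>F\<close> lies in the set under consideration, which is
  therefore not shy.
\<close>


section \<open>Box, packing and Hausdorff dimension\<close>

text \<open>\<open>covering_number\<close> wants balls centred in the set itself. Choosing a point
  of \<open>X\<close> in each member of \<open>P\<close> that meets \<open>X\<close> provides such
  centres, and the bound on distances within a member becomes the radius.\<close>

lemma ex_centers:
  fixes X :: "'a::metric_space set"
  assumes "finite P" "X \<subseteq> \<Union>P" "\<And>S x y. S \<in> P \<Longrightarrow> x \<in> S \<Longrightarrow> y \<in> S \<Longrightarrow> dist x y \<le> \<delta>"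
  obtains C where "finite C" "card C \<le> card P" "C \<subseteq> X" "X \<subseteq> (\<Union>c\<in>C. cball c \<delta>)"
proof -
  define Q where "Q = {S \<in> P. S \<inter> X \<noteq> {}}"
  have Q: "finite Q" "Q \<subseteq> P"
    using assms(1) by (auto simp: Q_def)
  have "\<forall>S\<in>Q. \<exists>x. x \<in> S \<inter> X"
    by (auto simp: Q_def)
  then obtain c where c: "\<And>S. S \<in> Q \<Longrightarrow> c S \<in> S \<inter> X"
    by metis
  show ?thesis
  proof (rule that[of "c ` Q"])
    show "card (c ` Q) \<le> card P"
      using card_image_le[OF Q(1)] card_mono[OF assms(1) Q(2)] le_trans by blast
    show "X \<subseteq> (\<Union>x\<in>c ` Q. cball x \<delta>)"
    proof
      fix x assume x: "x \<in> X"
      then obtain S where S: "S \<in> P" "x \<in> S"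
        using assms(2) by auto
      then have "S \<in> Q"
        using x by (auto simp: Q_def)
      then show "x \<in> (\<Union>x\<in>c ` Q. cball x \<delta>)"
        using assms(3)[OF S(1) _ S(2), of "c S"] c[of S] by auto
    qed
  qed (use Q c in auto)
qed

text \<open>Total boundedness makes the \<open>LEAST\<close> in \<open>covering_number\<close>
  attained. It provides centres anywhere in the space, so balls of radius
  \<open>\<delta> / 2\<close> are taken first and then recentred in \<open>X\<close> at the cost of
  a factor \<open>2\<close>.\<close>

lemma covering_number_cover:
  fixes X :: "'a::metric_space set"
  assumes "totally_bounded X" "\<delta> > 0"
  obtains C where "finite C" "card C = covering_number \<delta> X" "C \<subseteq> X" "X \<subseteq> (\<Union>c\<in>C. cball c \<delta>)"
proof -
  have "\<delta> / 2 > 0"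
    using assms by simp
  then obtain k where k: "finite k" "X \<subseteq> (\<Union>x\<in>k. {y. dist x y < \<delta> / 2})"
    using assms(1) unfolding totally_bounded_metric by blast
  obtain C where "finite C" "C \<subseteq> X" "X \<subseteq> (\<Union>c\<in>C. cball c \<delta>)"
  proof (rule ex_centers[of "(\<lambda>x. {y. dist x y < \<delta> / 2}) ` k" X \<delta>])
    fix S x y assume "S \<in> (\<lambda>x. {y. dist x y < \<delta> / 2}) ` k" "x \<in> S" "y \<in> S"
    then obtain z where "dist z x < \<delta> / 2" "dist z y < \<delta> / 2"
      by auto
    then show "dist x y \<le> \<delta>"
      using dist_triangle3[of x y z] by linarith
  qed (use k that in auto)
  then have "\<exists>C. finite C \<and> card C = covering_number \<delta> X \<and> C \<subseteq> X \<and> X \<subseteq> (\<Union>c\<in>C. cball c \<delta>)"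
    unfolding covering_number_def
    by (intro LeastI_ex[where P = "\<lambda>n. \<exists>C. finite C \<and> card C = n \<and> C \<subseteq> X \<and>
      X \<subseteq> (\<Union>c\<in>C. cball c \<delta>)"]) blast
  then show ?thesis
    using that by blast
qed

lemma covering_number_pos:
  fixes X :: "'a::metric_space set"
  assumes "totally_bounded X" "\<delta> > 0" "X \<noteq> {}"
  shows "covering_number \<delta> X > 0"
  by (rule covering_number_cover[OF assms(1,2)]) (use assms(3) in fastforce)

text \<open>Taking logarithms of the bound on \<open>card P\<close> gives a quotient of at most
  \<open>s + ln M / ln (1 / \<delta>)\<close>, whose second term vanishes as \<open>\<delta>\<close>
  tends to \<open>0\<close>. The same covers show that \<open>X\<close> is totally bounded.\<close>

lemma upper_box_dim_le:
  fixes X :: "'a::metric_space set"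
  assumes "0 \<le> s" "0 < M"
    and cover: "\<And>\<delta>. 0 < \<delta> \<Longrightarrow> \<delta> < 1 \<Longrightarrow> \<exists>P. finite P \<and> real (card P) \<le> M * \<delta> powr (- s) \<and>
      X \<subseteq> \<Union>P \<and> (\<forall>S\<in>P. \<forall>x\<in>S. \<forall>y\<in>S. dist x y \<le> \<delta>)"
  shows "upper_box_dim X \<le> ereal s"
proof (cases "X = {}")
  case True
  then show ?thesis
    using assms(1) by (simp add: upper_box_dim_def one_ereal_def)
next
  case False
  have centers: "\<exists>C. finite C \<and> real (card C) \<le> M * \<delta> powr (- s) \<and> C \<subseteq> X \<and> X \<subseteq> (\<Union>c\<in>C. cball c \<delta>)"
    if \<delta>: "0 < \<delta>" "\<delta> < 1" for \<delta>
  proof -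
    obtain P where P: "finite P" "real (card P) \<le> M * \<delta> powr (- s)" "X \<subseteq> \<Union>P"
      "\<And>S x y. S \<in> P \<Longrightarrow> x \<in> S \<Longrightarrow> y \<in> S \<Longrightarrow> dist x y \<le> \<delta>"
      using cover[OF \<delta>] by blast
    obtain C where "finite C" "card C \<le> card P" "C \<subseteq> X" "X \<subseteq> (\<Union>c\<in>C. cball c \<delta>)"
      by (rule ex_centers[OF P(1,3,4)])
    then show ?thesis
      using P(2) by (intro exI[of _ C]) auto
  qed
  have tb: "totally_bounded X"
    unfolding totally_bounded_metric
  proof (intro allI impI)
    fix e :: real assume "e > 0"
    \<comment> \<open>This keeps the scale below \<open>1\<close>, where covers are available, and
      strictly below \<open>e\<close>, because total boundedness speaks of open balls.\<close>
    define \<delta> where "\<delta> = min (e / 2) (1 / 2)"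
    have \<delta>: "0 < \<delta>" "\<delta> < 1" "\<delta> < e"
      using \<open>e > 0\<close> by (auto simp: \<delta>_def)
    obtain C where C: "finite C" "X \<subseteq> (\<Union>c\<in>C. cball c \<delta>)"
      using centers[OF \<delta>(1,2)] by blast
    have "X \<subseteq> (\<Union>x\<in>C. {y. dist x y < e})"
    proof
      fix x assume "x \<in> X"
      then obtain c where "c \<in> C" "dist c x \<le> \<delta>"
        using C(2) by auto
      then show "x \<in> (\<Union>x\<in>C. {y. dist x y < e})"
        using \<delta>(3) by (intro UN_I[of c]) auto
    qed
    with C(1) show "\<exists>k. finite k \<and> X \<subseteq> (\<Union>x\<in>k. {y. dist x y < e})"
      by blast
  qed
  let ?r = "\<lambda>\<delta>. ln (real (covering_number \<delta> X)) / ln (1 / \<delta>)"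
  have le: "?r \<delta> \<le> s + ln M / ln (1 / \<delta>)" if \<delta>: "0 < \<delta>" "\<delta> < 1" for \<delta>
  proof -
    obtain C where C: "finite C" "real (card C) \<le> M * \<delta> powr (- s)" "C \<subseteq> X" "X \<subseteq> (\<Union>c\<in>C. cball c \<delta>)"
      using centers[OF \<delta>] by blast
    have "covering_number \<delta> X \<le> card C"
      unfolding covering_number_def by (rule Least_le) (use C in blast)
    then have "real (covering_number \<delta> X) \<le> M * \<delta> powr (- s)"
      using C(2) by linarith
    then have "ln (real (covering_number \<delta> X)) \<le> ln (M * \<delta> powr (- s))"
      using covering_number_pos[OF tb \<delta>(1) False] by (subst ln_le_cancel_iff) (auto simp: assms \<delta>)
    also have "\<dots> = ln M + s * ln (1 / \<delta>)"
      using assms \<delta> by (simp add: ln_mult ln_powr ln_div)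
    finally have "?r \<delta> \<le> (ln M + s * ln (1 / \<delta>)) / ln (1 / \<delta>)"
      using \<delta> by (intro divide_right_mono) auto
    also have "\<dots> = s + ln M / ln (1 / \<delta>)"
      using \<delta> by (simp add: add_divide_distrib)
    finally show ?thesis .
  qed
  have "upper_box_dim X = Limsup (at_right 0) (\<lambda>\<delta>. ereal (?r \<delta>))"
    using False tb by (simp add: upper_box_dim_def)
  also have "\<dots> \<le> Limsup (at_right 0) (\<lambda>\<delta>. ereal (s + ln M / ln (1 / \<delta>)))"
    by (intro Limsup_mono eventually_mono[OF eventually_at_right_real[of 0 1]]) (use le in auto)
  also have "\<dots> = ereal s"
  proof (rule lim_imp_Limsup)
    have "((\<lambda>\<delta>. s + ln M / ln (1 / \<delta>)) \<longlongrightarrow> s) (at_right 0)"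
      by real_asymp
    then show "((\<lambda>\<delta>. ereal (s + ln M / ln (1 / \<delta>))) \<longlongrightarrow> ereal s) (at_right 0)"
      by simp
  qed simp
  finally show ?thesis .
qed

lemma upper_box_dim_nonneg:
  fixes X :: "'a::metric_space set"
  assumes "X \<noteq> {}"
  shows "upper_box_dim X \<ge> 0"
proof (cases "totally_bounded X")
  case True
  have "Limsup (at_right 0) (\<lambda>\<delta>::real. 0 :: ereal)
      \<le> Limsup (at_right 0) (\<lambda>\<delta>. ereal (ln (real (covering_number \<delta> X)) / ln (1 / \<delta>)))"
  proof (intro Limsup_mono eventually_mono[OF eventually_at_right_real[of 0 1]])
    fix \<delta> :: real assume "\<delta> \<in> {0<..<1}"
    then show "0 \<le> ereal (ln (real (covering_number \<delta> X)) / ln (1 / \<delta>))"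
      using covering_number_pos[OF True, of \<delta>] assms
      by (auto intro!: divide_nonneg_nonneg simp: Suc_le_eq)
  qed simp
  then show ?thesis
    using assms True by (simp add: upper_box_dim_def Limsup_const)
qed (simp add: upper_box_dim_def assms)

section \<open>Comparison of Hausdorff and packing dimension\<close>

text \<open>For some \<open>s' < s\<close> and all small \<open>d\<close>, fewer than
  \<open>d powr (- s')\<close> balls of radius \<open>d\<close> cover \<open>X\<close>. Their
  diameters are at most \<open>2 * d\<close>, so the sum is at most
  \<open>2 powr s * d powr (s - s')\<close>, which tends to \<open>0\<close>.\<close>

lemma hausdorff_premeasure_eq_0_if_upper_box_dim_less:
  fixes X :: "'a::metric_space set"
  assumes "upper_box_dim X < ereal s" "0 < s" "0 < \<delta>"
  shows "hausdorff_premeasure s \<delta> X = 0"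
proof (cases "X = {}")
  case True
  then show ?thesis
    unfolding hausdorff_premeasure_def using assms(3)
    by (intro antisym Inf_lower) (auto intro!: exI[of _ "\<lambda>_. {}"] simp: diam_pow_def)
next
  case False
  have tb: "totally_bounded X"
    using assms(1) False by (auto simp: upper_box_dim_def split: if_splits)
  let ?N = "\<lambda>d. covering_number d X"
  have "Limsup (at_right 0) (\<lambda>d. ereal (ln (real (?N d)) / ln (1 / d))) < ereal s"
    using assms(1) False tb by (simp add: upper_box_dim_def)
  then obtain s' where s': "Limsup (at_right 0) (\<lambda>d. ereal (ln (real (?N d)) / ln (1 / d))) < ereal s'" "s' < s"
    using ereal_dense2[of _ "ereal s"] by (metis less_ereal.simps(1))
  have ev1: "\<forall>\<^sub>F d in at_right 0. ln (real (?N d)) / ln (1 / d) < s'"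
    using Limsup_lessD[OF s'(1)] by simp
  have "0 < s - s'"
    using s'(2) by simp
  then have lim: "((\<lambda>d::real. 2 powr s * d powr (s - s')) \<longlongrightarrow> 0) (at_right 0)"
    by real_asymp
  have "hausdorff_premeasure s \<delta> X \<le> ennreal e" if "e > 0" for e
  proof -
    have ev2: "\<forall>\<^sub>F d in at_right 0. 2 powr s * d powr (s - s') < e"
      using order_tendstoD(2)[OF lim that] .
    have ev3: "\<forall>\<^sub>F d in at_right 0. d \<in> {0<..<min 1 (\<delta> / 2)}"
      using assms(3) by (intro eventually_at_right_real) simp
    obtain d where d: "ln (real (?N d)) / ln (1 / d) < s'" "2 powr s * d powr (s - s') < e"
        "d \<in> {0<..<min 1 (\<delta> / 2)}"
      using eventually_happens[OF eventually_conj[OF ev1 eventually_conj[OF ev2 ev3]]] by auto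
    have d': "0 < d" "d < 1" "2 * d \<le> \<delta>"
      using d(3) by auto
    have "ln (real (?N d)) < s' * ln (1 / d)"
      using d(1) d' by (simp add: divide_simps ln_div)
    also have "\<dots> = ln (d powr (- s'))"
      using d' by (simp add: ln_powr ln_div)
    finally have N: "real (?N d) < d powr (- s')"
      using covering_number_pos[OF tb d'(1) False] d' by (subst (asm) ln_less_cancel_iff) auto
    obtain C where C: "finite C" "card C = ?N d" "X \<subseteq> (\<Union>c\<in>C. cball c d)"
      using covering_number_cover[OF tb d'(1)] by metis
    obtain c where c: "bij_betw c {..<?N d} C"
      using ex_bij_betw_nat_finite[OF C(1)] C(2) by (auto simp: atLeast0LessThan)
    \<comment> \<open>The premeasure is defined by infinite sequences; the finite cover is continued
      by empty sets, on which \<open>diam_pow\<close> vanishes.\<close>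
    define U where "U i = (if i < ?N d then cball (c i) d else {})" for i
    have diam: "diameter (U i) \<le> 2 * d" for i
    proof -
      have "dist x y \<le> 2 * d" if xy: "x \<in> U i" "y \<in> U i" for x y
      proof -
        from xy have "dist (c i) x \<le> d" "dist (c i) y \<le> d"
          by (auto simp: U_def split: if_splits)
        then show ?thesis
          using dist_triangle3[of x y "c i"] by linarith
      qed
      then show ?thesis
        using d' by (auto simp: diameter_def intro!: cSUP_least)
    qed
    have "hausdorff_premeasure s \<delta> X \<le> (\<Sum>i. diam_pow s (U i))"
      unfolding hausdorff_premeasure_def
    proof (rule Inf_lower, rule CollectI, rule exI[of _ U], intro conjI allI refl)
      show "X \<subseteq> (\<Union>i. U i)"
        using C(3) c unfolding bij_betw_def by (fastforce simp: U_def)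
      show "bounded (U i)" for i
        by (simp add: U_def)
      show "diameter (U i) \<le> \<delta>" for i
        using diam[of i] d'(3) by linarith
    qed
    also have "\<dots> = (\<Sum>i<?N d. diam_pow s (U i))"
      by (rule suminf_finite) (auto simp: U_def diam_pow_def)
    also have "\<dots> \<le> (\<Sum>i<?N d. ennreal ((2 * d) powr s))"
    proof (rule sum_mono)
      fix i
      show "diam_pow s (U i) \<le> ennreal ((2 * d) powr s)"
      proof (cases "U i = {}")
        case False
        then have "diameter (U i) \<ge> 0"
          by (intro diameter_ge_0) (simp add: U_def)
        with diam[of i] assms(2) show ?thesis
          by (auto simp: diam_pow_def intro!: ennreal_leI powr_mono2)
      qed (simp add: diam_pow_def)
    qed
    also have "\<dots> = ennreal (real (?N d) * (2 * d) powr s)"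
      by (simp add: ennreal_mult ennreal_of_nat_eq_real_of_nat)
    also have "\<dots> \<le> ennreal e"
    proof (rule ennreal_leI)
      have "real (?N d) * (2 * d) powr s \<le> d powr (- s') * (2 * d) powr s"
        using N by (intro mult_right_mono) auto
      also have "\<dots> = 2 powr s * d powr (s - s')"
        using d' by (simp add: powr_mult powr_diff powr_minus field_simps)
      finally show "real (?N d) * (2 * d) powr s \<le> e"
        using d(2) by linarith
    qed
    finally show ?thesis .
  qed
  then have "hausdorff_premeasure s \<delta> X \<le> 0"
    by - (rule ennreal_le_epsilon, simp)
  then show ?thesis
    by simp
qed

text \<open>Each \<open>F i\<close> has a cover of total weight below \<open>e / 2 ^ Suc i\<close>.
  The double sequence of covering sets, enumerated by \<open>prod_decode\<close>, covers the union
  with total weight at most \<open>e\<close>.\<close>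

lemma hausdorff_premeasure_UN_eq_0:
  fixes F :: "nat \<Rightarrow> 'a::metric_space set"
  assumes "\<And>i. hausdorff_premeasure s \<delta> (F i) = 0"
  shows "hausdorff_premeasure s \<delta> (\<Union>i. F i) = 0"
proof -
  have "hausdorff_premeasure s \<delta> (\<Union>i. F i) \<le> ennreal e" if e: "e > 0" for e
  proof -
    define P where "P i U \<longleftrightarrow> F i \<subseteq> (\<Union>j. U j) \<and> (\<forall>j. bounded (U j) \<and> diameter (U j) \<le> \<delta>) \<and>
        (\<Sum>j. diam_pow s (U j)) < ennreal (e * (1 / 2) ^ Suc i)" for i U
    have "\<exists>U. P i U" for i
    proof -
      have "hausdorff_premeasure s \<delta> (F i) < ennreal (e * (1 / 2) ^ Suc i)"
        using assms e by simp
      then obtain m where m: "m \<in> {(\<Sum>j. diam_pow s (U j)) |U. F i \<subseteq> (\<Union>j. U j) \<and>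
          (\<forall>j. bounded (U j) \<and> diameter (U j) \<le> \<delta>)}" "m < ennreal (e * (1 / 2) ^ Suc i)"
        unfolding hausdorff_premeasure_def Inf_less_iff by (rule bexE)
      from m(1) obtain U where "m = (\<Sum>j. diam_pow s (U j))" "F i \<subseteq> (\<Union>j. U j)"
          "\<forall>j. bounded (U j) \<and> diameter (U j) \<le> \<delta>"
        by (elim CollectE exE conjE)
      then show ?thesis
        using m(2) by (intro exI[of _ U]) (simp only: P_def simp_thms)
    qed
    then obtain U where P: "\<And>i. P i (U i)"
      by metis
    have U: "F i \<subseteq> (\<Union>j. U i j)" "bounded (U i j)" "diameter (U i j) \<le> \<delta>"
        "(\<Sum>j. diam_pow s (U i j)) < ennreal (e * (1 / 2) ^ Suc i)" for i j
      using P[of i] unfolding P_def by simp_all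
    define V where "V n = (case prod_decode n of (i, j) \<Rightarrow> U i j)" for n
    have "hausdorff_premeasure s \<delta> (\<Union>i. F i) \<le> (\<Sum>n. diam_pow s (V n))"
      unfolding hausdorff_premeasure_def
    proof (rule Inf_lower, rule CollectI, rule exI[of _ V], intro conjI allI refl)
      show "(\<Union>i. F i) \<subseteq> (\<Union>n. V n)"
      proof
        fix x assume "x \<in> (\<Union>i. F i)"
        then obtain i j where "x \<in> U i j"
          using U(1) by blast
        then have "x \<in> V (prod_encode (i, j))"
          by (simp add: V_def)
        then show "x \<in> (\<Union>n. V n)"
          by blast
      qed
      show "bounded (V n)" "diameter (V n) \<le> \<delta>" for n
        by (simp_all add: V_def U case_prod_unfold)
    qed
    also have "\<dots> = (\<Sum>i. \<Sum>j. diam_pow s (U i j))"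
      using suminf_ennreal_2dimen[of "\<lambda>i. \<Sum>j. diam_pow s (U i j)" "\<lambda>(i, j). diam_pow s (U i j)"]
      by (simp add: V_def case_prod_unfold)
    also have "\<dots> \<le> (\<Sum>i. ennreal (e * (1 / 2) ^ Suc i))"
      by (intro suminf_le less_imp_le[OF U(4)] summableI)
    also have "\<dots> = ennreal e"
      using sums_mult[OF power_half_series, of e] e
      by (subst suminf_ennreal_eq[where x = e]) auto
    finally show ?thesis .
  qed
  then have "hausdorff_premeasure s \<delta> (\<Union>i. F i) \<le> 0"
    by - (rule ennreal_le_epsilon, simp)
  then show ?thesis
    by simp
qed

text \<open>If \<open>s\<close> lay strictly between the supremum of the box dimensions in a
  decomposition and the Hausdorff dimension, every piece and hence \<open>X\<close> would have
  premeasure \<open>0\<close> at every scale. A nonempty piece makes the supremum nonnegative,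
  whence \<open>s > 0\<close>.\<close>

lemma hausdorff_dim_le_packing_dim:
  fixes X :: "'a::metric_space set"
  shows "hausdorff_dim X \<le> packing_dim X"
proof (cases "X = {}")
  case False
  show ?thesis
    unfolding packing_dim_def
  proof (rule Inf_greatest, clarify)
    fix F :: "nat \<Rightarrow> 'a set" assume X: "X = (\<Union>i. F i)"
    let ?S = "SUP i. upper_box_dim (F i)"
    obtain i where "F i \<noteq> {}"
      using X False by auto
    then have S: "?S \<ge> 0"
      using upper_box_dim_nonneg[of "F i"] by (intro SUP_upper2[of i]) auto
    have "hausdorff_dim X \<le> ?S"
    proof (rule ccontr)
      assume "\<not> ?thesis"
      then obtain s where s: "?S < ereal s" "ereal s < hausdorff_dim X"
        using ereal_dense2[of ?S "hausdorff_dim X"] by (metis not_le)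
      have "s > 0"
        using order_le_less_trans[OF S s(1)] by simp
      have "upper_box_dim (F i) < ereal s" for i
        by (rule order_le_less_trans[OF SUP_upper s(1)]) simp
      then have "hausdorff_premeasure s \<delta> X = 0" if "\<delta> > 0" for \<delta>
        unfolding X using \<open>s > 0\<close> that
        by (intro hausdorff_premeasure_UN_eq_0 hausdorff_premeasure_eq_0_if_upper_box_dim_less)
      then have "hausdorff_measure s X = 0"
        unfolding hausdorff_measure_def by (intro antisym SUP_least) auto
      then have "hausdorff_dim X \<le> ereal s"
        unfolding hausdorff_dim_def using False \<open>s > 0\<close>
        by (simp add: Inf_lower)
      with s(2) show False
        by simp
    qed
    then show "hausdorff_dim (\<Union>i. F i) \<le> ?S"
      using X by simp
  qed
qed (simp add: hausdorff_dim_empty packing_dim_empty)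

text \<open>The decompositions in \<open>packing_dim\<close> have union equal to \<open>X\<close>,
  so a cover is first intersected with \<open>X\<close>.\<close>

lemma packing_dim_le_UN:
  fixes F :: "nat \<Rightarrow> 'a::metric_space set"
  assumes "X \<subseteq> (\<Union>i. F i)" "\<And>i. upper_box_dim (X \<inter> F i) \<le> c"
  shows "packing_dim X \<le> c"
proof -
  have "packing_dim X \<le> (SUP i. upper_box_dim (X \<inter> F i))"
    unfolding packing_dim_def
    by (rule Inf_lower, rule CollectI, rule exI[of _ "\<lambda>i. X \<inter> F i"]) (use assms(1) in auto)
  also have "\<dots> \<le> c"
    using assms(2) by (intro SUP_least)
  finally show ?thesis .
qed


section \<open>Cantor sets from binary digits\<close>

text \<open>Digit \<open>i\<close> has weight \<open>(1 / 2) ^ Suc i\<close>. The floor selects the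
  terminating expansion of a dyadic rational.\<close>

definition binary_digit :: "real \<Rightarrow> nat \<Rightarrow> int" where
  "binary_digit t i = \<lfloor>2 ^ Suc i * t\<rfloor> mod 2"

text \<open>The digits of \<open>t\<close> in base \<open>2\<close>, read in base \<open>1 / r\<close>: the inverse of a Cantor function.\<close>

definition digit_sum :: "real \<Rightarrow> real \<Rightarrow> real" where
  "digit_sum r t = (\<Sum>i. r ^ i * of_int (binary_digit t i))"

lemma binary_digit_cases: "binary_digit t i = 0 \<or> binary_digit t i = 1"
  unfolding binary_digit_def by presburger

text \<open>Comparison with the geometric series starting at \<open>r ^ k\<close>.\<close>

lemma abs_power_series_tail_le:
  fixes r :: real
  assumes r: "0 < r" "r < 1" and d: "\<And>i. \<bar>d i\<bar> \<le> 1" "\<And>i. i < k \<Longrightarrow> d i = 0"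
  shows "\<bar>\<Sum>i. r ^ i * d i\<bar> \<le> r ^ k / (1 - r)" "summable (\<lambda>i. r ^ i * d i)"
proof -
  have geo: "summable (\<lambda>i. r ^ i)"
    using r by (intro summable_geometric) simp
  have le: "norm (r ^ i * d i) \<le> r ^ i" for i
    using d(1)[of i] r by (simp add: abs_mult mult_left_le)
  show sum: "summable (\<lambda>i. r ^ i * d i)"
    by (rule summable_comparison_test'[OF geo le])
  have "(\<Sum>i. r ^ i * d i) = (\<Sum>i. r ^ (i + k) * d (i + k)) + (\<Sum>i<k. r ^ i * d i)"
    by (rule suminf_split_initial_segment[OF sum])
  also have "(\<Sum>i<k. r ^ i * d i) = 0"
    by (intro sum.neutral) (use d(2) in auto)
  finally have "\<bar>\<Sum>i. r ^ i * d i\<bar> = norm (\<Sum>i. r ^ (i + k) * d (i + k))"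
    by simp
  also have "\<dots> \<le> (\<Sum>i. r ^ (i + k))"
    by (rule norm_suminf_le[OF le]) (use geo in \<open>simp add: summable_iff_shift\<close>)
  also have "\<dots> = r ^ k * (\<Sum>i. r ^ i)"
    using suminf_mult[OF geo, of "r ^ k"] by (simp add: power_add mult.commute)
  also have "\<dots> = r ^ k / (1 - r)"
    using r by (simp add: suminf_geometric)
  finally show "\<bar>\<Sum>i. r ^ i * d i\<bar> \<le> r ^ k / (1 - r)" .
qed

text \<open>The first nonzero term has size \<open>r ^ k\<close>, and all later ones together
  contribute at most \<open>r ^ Suc k / (1 - r)\<close>. The difference is positive when
  \<open>r < 1 / 2\<close>.\<close>

lemma abs_power_series_ge:
  fixes r :: real
  assumes r: "0 < r" "r < 1" and d: "\<And>i. \<bar>d i\<bar> \<le> 1" "\<And>i. i < k \<Longrightarrow> d i = 0" "\<bar>d k\<bar> = 1"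
  shows "r ^ k * ((1 - 2 * r) / (1 - r)) \<le> \<bar>\<Sum>i. r ^ i * d i\<bar>"
proof -
  define e where "e i = (if i \<le> k then 0 else d i)" for i
  have e: "\<And>i. \<bar>e i\<bar> \<le> 1" "\<And>i. i < Suc k \<Longrightarrow> e i = 0"
    using d(1) by (auto simp: e_def)
  have "(\<lambda>i. r ^ i * d i) = (\<lambda>i. (if i = k then r ^ k * d k else 0) + r ^ i * e i)"
    using d(2) by (auto simp: fun_eq_iff e_def)
  then have "(\<Sum>i. r ^ i * d i) = (\<Sum>i. (if i = k then r ^ k * d k else 0)) + (\<Sum>i. r ^ i * e i)"
    using suminf_add[OF sums_summable[OF sums_single[of k "\<lambda>i. r ^ k * d k"]]
        abs_power_series_tail_le(2)[of r e "Suc k", OF r e]] by simp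
  also have "(\<Sum>i. (if i = k then r ^ k * d k else 0)) = r ^ k * d k"
    using sums_unique[OF sums_single[of k "\<lambda>i. r ^ k * d k"]] by simp
  finally have "(\<Sum>i. r ^ i * d i) = r ^ k * d k + (\<Sum>i. r ^ i * e i)" .
  moreover have "\<bar>r ^ k * d k\<bar> = r ^ k"
    using d(3) r by (simp add: abs_mult)
  ultimately have "r ^ k - r ^ Suc k / (1 - r) \<le> \<bar>\<Sum>i. r ^ i * d i\<bar>"
    using abs_power_series_tail_le(1)[of r e "Suc k", OF r e] by linarith
  also have "r ^ k - r ^ Suc k / (1 - r) = r ^ k * ((1 - 2 * r) / (1 - r))"
    using r by (simp add: field_simps)
  finally show ?thesis .
qed

text \<open>The coarser floor is determined by the finer one through integer division by
  \<open>2 ^ (k - i)\<close>.\<close>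

lemma floor_eq_mono:
  assumes "\<lfloor>2 ^ k * (t::real)\<rfloor> = \<lfloor>2 ^ k * (u::real)\<rfloor>" "i \<le> k"
  shows "\<lfloor>2 ^ i * t\<rfloor> = \<lfloor>2 ^ i * u\<rfloor>"
proof -
  have eq: "\<lfloor>2 ^ i * x\<rfloor> = \<lfloor>2 ^ k * x\<rfloor> div 2 ^ (k - i)" for x :: real
  proof -
    have "2 ^ i * x = 2 ^ k * x / real_of_int (2 ^ (k - i))"
      using assms(2) by (simp add: field_simps flip: power_add)
    then show ?thesis
      by (simp only: floor_divide_real_eq_div zero_le_power zero_le_numeral)
  qed
  show ?thesis
    by (simp only: eq assms(1))
qed

lemma digit_sum_diff:
  assumes "0 < r" "r < 1"
  shows "digit_sum r t - digit_sum r u =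
    (\<Sum>i. r ^ i * (of_int (binary_digit t i) - of_int (binary_digit u i)))"
proof -
  have "summable (\<lambda>i. r ^ i * of_int (binary_digit x i))" for x
  proof (rule abs_power_series_tail_le(2)[OF assms, of _ 0])
    show "\<bar>of_int (binary_digit x i)\<bar> \<le> (1::real)" for i
      using binary_digit_cases[of x i] by auto
  qed simp
  then show ?thesis
    unfolding digit_sum_def by (subst suminf_diff) (auto simp: algebra_simps)
qed

lemma abs_binary_digit_diff_le: "\<bar>of_int (binary_digit t i) - of_int (binary_digit u i)\<bar> \<le> (1::real)"
  using binary_digit_cases[of t i] binary_digit_cases[of u i] by auto

text \<open>Two numbers in the same dyadic interval of level \<open>k\<close> share their first
  \<open>k\<close> digits.\<close>

lemma digit_sum_close:
  assumes "0 < r" "r < 1" "\<lfloor>2 ^ k * t\<rfloor> = \<lfloor>2 ^ k * u\<rfloor>"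
  shows "\<bar>digit_sum r t - digit_sum r u\<bar> \<le> r ^ k / (1 - r)"
  unfolding digit_sum_diff[OF assms(1,2)]
proof (rule abs_power_series_tail_le(1)[OF assms(1,2) abs_binary_digit_diff_le])
  fix i assume "i < k"
  then have "\<lfloor>2 ^ Suc i * t\<rfloor> = \<lfloor>2 ^ Suc i * u\<rfloor>"
    by (intro floor_eq_mono[OF assms(3)]) simp
  then show "of_int (binary_digit t i) - of_int (binary_digit u i) = (0::real)"
    unfolding binary_digit_def by simp
qed

text \<open>Let \<open>k\<close> be a level at which \<open>t\<close> and \<open>u\<close> share a
  dyadic interval while they no longer do at level \<open>Suc k\<close>. The common interval bounds
  \<open>\<bar>t - u\<bar>\<close>, and the first differing digit, number \<open>k\<close>,
  separates the digit sums.\<close>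

lemma digit_sum_separated:
  assumes r: "0 < r" "r < 1" and tu: "t \<in> {0..<1}" "u \<in> {0..<1}" "t \<noteq> u"
  obtains k where "\<bar>t - u\<bar> \<le> (1 / 2) ^ k"
    "r ^ k * ((1 - 2 * r) / (1 - r)) \<le> \<bar>digit_sum r t - digit_sum r u\<bar>"
proof -
  have "\<exists>k. \<lfloor>2 ^ k * t\<rfloor> \<noteq> \<lfloor>2 ^ k * u\<rfloor>"
  proof -
    obtain k where "1 / \<bar>t - u\<bar> < 2 ^ k"
      using real_arch_pow[of 2 "1 / \<bar>t - u\<bar>"] by auto
    then have "1 < 2 ^ k * \<bar>t - u\<bar>"
      using tu(3) by (simp add: field_simps)
    also have "\<dots> = \<bar>2 ^ k * t - 2 ^ k * u\<bar>"
      by (simp add: abs_mult flip: right_diff_distrib)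
    finally show ?thesis
      by (intro exI[of _ k]) linarith
  qed
  moreover have "\<lfloor>2 ^ 0 * t\<rfloor> = \<lfloor>2 ^ 0 * u\<rfloor>"
    using tu by (simp add: floor_unique[of 0])
  ultimately obtain k where k: "\<lfloor>2 ^ Suc k * t\<rfloor> \<noteq> \<lfloor>2 ^ Suc k * u\<rfloor>" "\<lfloor>2 ^ k * t\<rfloor> = \<lfloor>2 ^ k * u\<rfloor>"
    using inc_induct[of 0 _ "\<lambda>k. \<lfloor>2 ^ k * t\<rfloor> \<noteq> \<lfloor>2 ^ k * u\<rfloor>"] by blast
  show ?thesis
  proof (rule that)
    have "2 ^ k * \<bar>t - u\<bar> = \<bar>2 ^ k * t - 2 ^ k * u\<bar>"
      by (simp add: abs_mult flip: right_diff_distrib)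
    also have "\<dots> \<le> 1"
      using k(2) by linarith
    finally show "\<bar>t - u\<bar> \<le> (1 / 2) ^ k"
      by (simp add: field_simps)
    show "r ^ k * ((1 - 2 * r) / (1 - r)) \<le> \<bar>digit_sum r t - digit_sum r u\<bar>"
      unfolding digit_sum_diff[OF r]
    proof (rule abs_power_series_ge[OF r abs_binary_digit_diff_le])
      fix i assume "i < k"
      then have "\<lfloor>2 ^ Suc i * t\<rfloor> = \<lfloor>2 ^ Suc i * u\<rfloor>"
        by (intro floor_eq_mono[OF k(2)]) simp
      then show "of_int (binary_digit t i) - of_int (binary_digit u i) = (0::real)"
        unfolding binary_digit_def by simp
    next
      \<comment> \<open>The floor of \<open>2 ^ k * x\<close> is half of the next one, rounded down,
        so two next floors that differ over a common half differ in parity, that is, in digit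
        \<open>k\<close>.\<close>
      have half: "\<lfloor>2 ^ k * x\<rfloor> = \<lfloor>2 ^ Suc k * x\<rfloor> div 2" for x :: real
        using floor_divide_real_eq_div[of 2 "2 ^ Suc k * x"] by simp
      have "binary_digit t k \<noteq> binary_digit u k"
        using k half[of t] half[of u] unfolding binary_digit_def by presburger
      then show "\<bar>of_int (binary_digit t k) - of_int (binary_digit u k)\<bar> = (1::real)"
        using binary_digit_cases[of t k] binary_digit_cases[of u k] by auto
    qed
  qed
qed

section \<open>Cantor sets: covers and dimension\<close>

text \<open>For \<open>0 < r < 1 / 2\<close> and \<open>c > 0\<close> this is a scaled copy of the
  self-similar set of the maps \<open>x \<mapsto> r * x\<close> and
  \<open>x \<mapsto> r * x + 1\<close>. Floors never produce expansions ending in ones; the closure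
  adds the corresponding limit points.\<close>

definition cantor :: "real \<Rightarrow> real \<Rightarrow> real set" where
  "cantor c r = closure ((\<lambda>t. c * digit_sum r t) ` {0..<1})"

lemma closed_cantor: "closed (cantor c r)"
  by (simp add: cantor_def)

lemma digit_sum_0: "digit_sum r 0 = 0"
  by (simp add: digit_sum_def binary_digit_def)

lemma zero_in_cantor: "0 \<in> cantor c r"
  unfolding cantor_def by (intro subsetD[OF closure_subset] image_eqI[of _ _ 0]) (auto simp: digit_sum_0)

lemma cantor_subset:
  assumes "0 < r" "r \<le> 1 / 2" "0 \<le> c"
  shows "cantor c r \<subseteq> {0..2 * c}"
  unfolding cantor_def
proof (rule closure_minimal)
  show "(\<lambda>t. c * digit_sum r t) ` {0..<1} \<subseteq> {0..2 * c}"
  proof clarify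
    fix t :: real assume "t \<in> {0..<1}"
    have r: "r < 1"
      using assms(2) by simp
    have d: "\<bar>of_int (binary_digit t i)\<bar> \<le> (1::real)" for i
      using binary_digit_cases[of t i] by auto
    have ab: "\<bar>digit_sum r t\<bar> \<le> r ^ 0 / (1 - r)" and sum: "summable (\<lambda>i. r ^ i * of_int (binary_digit t i))"
      unfolding digit_sum_def
      using abs_power_series_tail_le[OF assms(1) r d, of 0] by simp_all
    have "0 \<le> digit_sum r t"
      unfolding digit_sum_def using sum
    proof (rule suminf_nonneg)
      show "0 \<le> r ^ i * of_int (binary_digit t i)" for i
        using binary_digit_cases[of t i] assms(1) by auto
    qed
    moreover have "r ^ 0 / (1 - r) \<le> 2"
      using assms(2) by (simp add: field_simps)
    ultimately have "0 \<le> digit_sum r t" "digit_sum r t \<le> 2"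
      using ab by linarith+
    then show "c * digit_sum r t \<in> {0..2 * c}"
      using mult_left_mono[of "digit_sum r t" 2 c] assms(3) by simp
  qed
qed simp

text \<open>The pieces are the closed images of the \<open>2 ^ k\<close> dyadic intervals of level
  \<open>k\<close>. A finite union of closed sets is closed, so it contains the closure of the whole
  image.\<close>

lemma cantor_cover:
  assumes "0 < r" "r < 1" "0 \<le> c"
  obtains P where "finite P" "card P \<le> 2 ^ k" "cantor c r \<subseteq> \<Union>P"
    "\<And>S x y. S \<in> P \<Longrightarrow> x \<in> S \<Longrightarrow> y \<in> S \<Longrightarrow> dist x y \<le> c * (r ^ k / (1 - r))"
proof -
  define E where "E j = closure ((\<lambda>t. c * digit_sum r t) ` {t \<in> {0..<1}. \<lfloor>2 ^ k * t\<rfloor> = j})" for j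
  show ?thesis
  proof (rule that[of "E ` {0..<2 ^ k}"])
    show "card (E ` {0..<2 ^ k}) \<le> 2 ^ k"
      using card_image_le[of "{0..<2 ^ k}" E] by (simp add: nat_power_eq)
    have "closed (\<Union>(E ` {0..<2 ^ k}))"
      by (intro closed_UN) (auto simp: E_def)
    moreover have "(\<lambda>t. c * digit_sum r t) ` {0..<1} \<subseteq> \<Union>(E ` {0..<2 ^ k})"
    proof clarify
      fix t :: real assume t: "t \<in> {0..<1}"
      have "\<lfloor>2 ^ k * t\<rfloor> \<in> {0..<2 ^ k}"
        using t by (auto simp: floor_less_iff)
      moreover have "c * digit_sum r t \<in> E \<lfloor>2 ^ k * t\<rfloor>"
        unfolding E_def using t by (intro subsetD[OF closure_subset]) auto
      ultimately show "c * digit_sum r t \<in> \<Union>(E ` {0..<2 ^ k})"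
        by blast
    qed
    ultimately show "cantor c r \<subseteq> \<Union>(E ` {0..<2 ^ k})"
      unfolding cantor_def by (intro closure_minimal)
  next
    fix S x y assume "S \<in> E ` {0..<2 ^ k}" "x \<in> S" "y \<in> S"
    then obtain j where xy: "x \<in> E j" "y \<in> E j"
      by auto
    let ?A = "(\<lambda>t. c * digit_sum r t) ` {t \<in> {0..<1}. \<lfloor>2 ^ k * t\<rfloor> = j}"
    have xy': "x \<in> closure ?A" "y \<in> closure ?A"
      using xy by (simp_all add: E_def)
    have base: "dist a b \<le> c * (r ^ k / (1 - r))" if ab: "a \<in> ?A" "b \<in> ?A" for a b
    proof -
      obtain t where t: "a = c * digit_sum r t" "\<lfloor>2 ^ k * t\<rfloor> = j"
        using ab(1) by blast
      obtain u where u: "b = c * digit_sum r u" "\<lfloor>2 ^ k * u\<rfloor> = j"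
        using ab(2) by blast
      have tu: "\<lfloor>2 ^ k * t\<rfloor> = \<lfloor>2 ^ k * u\<rfloor>"
        using t u by simp
      have "dist a b = c * \<bar>digit_sum r t - digit_sum r u\<bar>"
        using assms(3) by (simp add: t u dist_real_def abs_mult flip: right_diff_distrib)
      then show ?thesis
        using mult_left_mono[OF digit_sum_close[OF assms(1,2) tu] assms(3)] by simp
    qed
    \<comment> \<open>The distance bound passes to the closure in one variable at a time.\<close>
    have "dist a y \<le> c * (r ^ k / (1 - r))" if a: "a \<in> ?A" for a
      by (rule continuous_le_on_closure[OF _ xy'(2)]) (use base[OF a] in \<open>auto intro!: continuous_intros\<close>)
    then show "dist x y \<le> c * (r ^ k / (1 - r))"
      by - (rule continuous_le_on_closure[OF _ xy'(1)], auto intro!: continuous_intros)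
  qed simp
qed

text \<open>The bound is the similarity dimension, the solution \<open>s\<close> of
  \<open>r powr s = 1 / 2\<close>. The scale \<open>\<delta>\<close> is matched with the level at
  which the pieces first become that small.\<close>

lemma upper_box_dim_subset_cantor_le:
  assumes r: "0 < r" "r < 1" and c: "0 < c" "c \<le> 1" and X: "X \<subseteq> cantor c r"
  shows "upper_box_dim X \<le> ereal (ln 2 / ln (1 / r))"
proof (rule upper_box_dim_le)
  let ?s = "ln 2 / ln (1 / r)" and ?M = "2 * (1 - r) powr (- (ln 2 / ln (1 / r)))"
  have s: "?s > 0"
    using r by simp
  then show "0 \<le> ?s"
    by simp
  show "0 < ?M"
    using r by simp
  have half: "(r ^ k) powr (- ?s) = 2 ^ k" for k
  proof -
    have "r powr (- ?s) = 2"
      using r by (simp add: powr_def ln_div)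
    moreover have "(r ^ k) powr (- ?s) = (r powr (- ?s)) ^ k"
      using r by (simp add: powr_powr mult.commute flip: powr_realpow)
    ultimately show ?thesis
      by simp
  qed
  fix \<delta> :: real assume \<delta>: "0 < \<delta>" "\<delta> < 1"
  have "\<exists>k. r ^ k \<le> (1 - r) * \<delta>"
    using real_arch_pow_inv[of "(1 - r) * \<delta>" r] r \<delta> by (auto intro: less_imp_le)
  moreover have "\<not> r ^ 0 \<le> (1 - r) * \<delta>"
    using r \<delta> mult_strict_mono[of "1 - r" 1 \<delta> 1] by simp
  ultimately obtain k where k: "r ^ Suc k \<le> (1 - r) * \<delta>" "(1 - r) * \<delta> < r ^ k"
    using inc_induct[of 0 _ "\<lambda>k. r ^ k \<le> (1 - r) * \<delta>"] by (metis le0 not_le)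
  obtain P where P: "finite P" "card P \<le> 2 ^ Suc k" "cantor c r \<subseteq> \<Union>P"
    "\<And>S x y. S \<in> P \<Longrightarrow> x \<in> S \<Longrightarrow> y \<in> S \<Longrightarrow> dist x y \<le> c * (r ^ Suc k / (1 - r))"
    using cantor_cover[of r c "Suc k"] r c by auto
  have le: "c * (r ^ Suc k / (1 - r)) \<le> \<delta>"
  proof -
    have "r ^ Suc k / (1 - r) \<le> \<delta>"
      using k(1) r by (simp add: divide_simps mult.commute)
    then show ?thesis
      using mult_mono[of c 1 "r ^ Suc k / (1 - r)" \<delta>] c r by simp
  qed
  \<comment> \<open>The cover uses level \<open>Suc k\<close>, while the lower bound on
    \<open>r ^ k\<close> controls level \<open>k\<close>; this is the factor \<open>2\<close> in
    \<open>?M\<close>.\<close>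
  have "real (card P) \<le> 2 * 2 ^ k"
    using P(2) by (metis of_nat_le_iff of_nat_numeral of_nat_power power_Suc)
  also have "2 ^ k = (r ^ k) powr (- ?s)"
    by (simp add: half)
  also have "\<dots> \<le> ((1 - r) * \<delta>) powr (- ?s)"
    using k(2) r \<delta> s by (intro powr_mono2') auto
  also have "2 * ((1 - r) * \<delta>) powr (- ?s) = ?M * \<delta> powr (- ?s)"
    using r \<delta> by (simp add: powr_mult)
  finally have card: "real (card P) \<le> ?M * \<delta> powr (- ?s)"
    by simp
  show "\<exists>P. finite P \<and> real (card P) \<le> ?M * \<delta> powr (- ?s) \<and> X \<subseteq> \<Union>P \<and>
      (\<forall>S\<in>P. \<forall>x\<in>S. \<forall>y\<in>S. dist x y \<le> \<delta>)"
  proof (intro exI conjI ballI)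
    show "X \<subseteq> \<Union>P"
      using X P(3) by (rule order_trans)
    show "dist x y \<le> \<delta>" if "S \<in> P" "x \<in> S" "y \<in> S" for S x y
      using P(4)[OF that] le by (rule order_trans)
  qed (use P(1) card in auto)
qed

text \<open>
  The inverse of the parametrization is Hoelder continuous with exponent \<open>s\<close>, so a cover of the
  Cantor set induces a cover of \<open>[0, 1)\<close> by intervals of controlled length.
\<close>

lemma hausdorff_measure_ne_0_if_cantor_subset:
  assumes r: "0 < r" "r < 1 / 2" and c: "0 < c" and s: "0 \<le> s" "1 / 2 \<le> r powr s"
    and K: "cantor c r \<subseteq> K"
  shows "hausdorff_measure s K \<noteq> 0"
proof -
  let ?g = "\<lambda>t. c * digit_sum r t"
  \<comment> \<open>\<open>\<kappa>\<close> is the separation constant of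
    \<open>digit_sum_separated\<close> scaled by \<open>c\<close>, \<open>A\<close> is the resulting
    Hoelder constant, and \<open>B\<close> bounds the length of an enclosing interval against
    \<open>diam_pow\<close>.\<close>
  define \<kappa> where "\<kappa> = c * ((1 - 2 * r) / (1 - r))"
  define A where "A = (1 / \<kappa>) powr s"
  define B where "B = 2 * (A + 1)"
  have \<kappa>: "\<kappa> > 0" and A: "A > 0"
    using r c by (auto simp: \<kappa>_def A_def)
  then have B: "B > 0"
    by (simp add: B_def)
  have holder: "\<bar>t - u\<bar> \<le> A * dist (?g t) (?g u) powr s" "?g t \<noteq> ?g u"
    if tu: "t \<in> {0..<1}" "u \<in> {0..<1}" "t \<noteq> u" for t u
  proof -
    obtain k where k: "\<bar>t - u\<bar> \<le> (1 / 2) ^ k"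
        "r ^ k * ((1 - 2 * r) / (1 - r)) \<le> \<bar>digit_sum r t - digit_sum r u\<bar>"
      using digit_sum_separated[OF r(1) _ tu] r(2) by auto
    have "dist (?g t) (?g u) = c * \<bar>digit_sum r t - digit_sum r u\<bar>"
      using c by (simp add: dist_real_def abs_mult flip: right_diff_distrib)
    then have le: "r ^ k * \<kappa> \<le> dist (?g t) (?g u)"
      using mult_left_mono[OF k(2), of c] c by (simp add: \<kappa>_def mult_ac)
    moreover have "0 < r ^ k * \<kappa>"
      using r \<kappa> by simp
    ultimately show "?g t \<noteq> ?g u"
      by force
    \<comment> \<open>Here \<open>1 / 2 \<le> r powr s\<close> turns the length of a dyadic interval
      into the power \<open>s\<close> of the separation at the same level.\<close>
    have "(1 / 2) ^ k \<le> (r powr s) ^ k"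
      using s by (intro power_mono) auto
    also have "\<dots> = (r ^ k) powr s"
      using r by (simp add: powr_powr mult.commute flip: powr_realpow)
    also have "\<dots> \<le> (1 / \<kappa> * dist (?g t) (?g u)) powr s"
      using le \<kappa> r s by (intro powr_mono2) (auto simp: field_simps)
    also have "\<dots> = A * dist (?g t) (?g u) powr s"
      using \<kappa> by (subst powr_mult) (auto simp: A_def)
    finally show "\<bar>t - u\<bar> \<le> A * dist (?g t) (?g u) powr s"
      using k(1) by linarith
  qed
  have "ennreal (1 / B) \<le> hausdorff_premeasure s 1 K"
      unfolding hausdorff_premeasure_def
    proof (rule Inf_greatest, clarify)
      fix U :: "nat \<Rightarrow> real set"
      assume U: "K \<subseteq> (\<Union>i. U i)" "\<forall>i. bounded (U i) \<and> diameter (U i) \<le> 1"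
      define V where "V i = {t \<in> {0..<1}. ?g t \<in> U i}" for i
      have V: "{0..<1} \<subseteq> (\<Union>i. V i)"
      proof
        fix t :: real assume t: "t \<in> {0..<1}"
        then have "?g t \<in> cantor c r"
          unfolding cantor_def by (intro subsetD[OF closure_subset]) auto
        then show "t \<in> (\<Union>i. V i)"
          using U(1) K t by (auto simp: V_def)
      qed
      \<comment> \<open>\<open>U i\<close> is arbitrary, so \<open>V i\<close> may fail to be
        measurable; it is enclosed in an interval around one of its points.\<close>
      have "\<exists>I. V i \<subseteq> I \<and> I \<in> sets lborel \<and> emeasure lborel I \<le> ennreal B * diam_pow s (U i)" for i
      proof (cases "V i = {}")
        case False
        then obtain t where t: "t \<in> V i"
          by auto
        define L where "L = (A + 1) * (if s = 0 then 1 else diameter (U i) powr s)"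
        have L: "L \<ge> 0"
          using A by (simp add: L_def)
        have "V i \<subseteq> {t - L..t + L}"
        proof
          fix u assume u: "u \<in> V i"
          have "\<bar>t - u\<bar> \<le> L"
          proof (cases "t = u")
            case False
            have tu: "t \<in> {0..<1}" "u \<in> {0..<1}"
              using t u by (auto simp: V_def)
            have d: "0 < dist (?g t) (?g u)"
              using holder(2)[OF tu False] by simp
            have "dist (?g t) (?g u) \<le> diameter (U i)"
              using t u U(2) by (intro diameter_bounded_bound) (auto simp: V_def)
            then have "dist (?g t) (?g u) powr s \<le> (if s = 0 then 1 else diameter (U i) powr s)"
              using d s by (auto intro!: powr_mono2)
            then have "A * dist (?g t) (?g u) powr s \<le> L"
              unfolding L_def using A by (intro mult_mono) auto
            then show ?thesis
              using holder(1)[OF tu False] by linarith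
          qed (use L in simp)
          then show "u \<in> {t - L..t + L}"
            by auto
        qed
        moreover have "emeasure lborel {t - L..t + L} = ennreal B * diam_pow s (U i)"
        proof -
          have "U i \<noteq> {}"
            using t by (auto simp: V_def)
          then have "diam_pow s (U i) = ennreal (if s = 0 then 1 else diameter (U i) powr s)"
            by (simp add: diam_pow_def)
          moreover have "emeasure lborel {t - L..t + L} = ennreal (2 * L)"
            using L by simp
          moreover have "2 * L = B * (if s = 0 then 1 else diameter (U i) powr s)"
            by (simp add: L_def B_def)
          ultimately show ?thesis
            using B by (simp add: ennreal_mult)
        qed
        ultimately show ?thesis
          by (intro exI[of _ "{t - L..t + L}"]) simp
      qed auto
      then obtain I where I: "\<And>i. V i \<subseteq> I i" "\<And>i. I i \<in> sets lborel"
          "\<And>i. emeasure lborel (I i) \<le> ennreal B * diam_pow s (U i)"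
        by metis
      have "ennreal 1 = emeasure lborel {0..<1::real}"
        by simp
      also have "\<dots> \<le> emeasure lborel (\<Union>i. I i)"
        using V I(1,2) by (intro emeasure_mono) blast+
      also have "\<dots> \<le> (\<Sum>i. emeasure lborel (I i))"
        using I(2) by (intro emeasure_subadditive_countably) auto
      also have "\<dots> \<le> (\<Sum>i. ennreal B * diam_pow s (U i))"
        by (intro suminf_le I(3) summableI)
      also have "\<dots> = ennreal B * (\<Sum>i. diam_pow s (U i))"
        by simp
      finally have "ennreal 1 \<le> ennreal B * (\<Sum>i. diam_pow s (U i))" .
      then have "ennreal (1 / B) * ennreal 1
          \<le> ennreal (1 / B) * (ennreal B * (\<Sum>i. diam_pow s (U i)))"
        by (rule mult_left_mono) simp
      also have "\<dots> = (\<Sum>i. diam_pow s (U i))"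
        using B by (simp flip: mult.assoc ennreal_mult)
      finally show "ennreal (1 / B) \<le> (\<Sum>i. diam_pow s (U i))"
        by simp
    qed
  also have "hausdorff_premeasure s 1 K \<le> hausdorff_measure s K"
    unfolding hausdorff_measure_def by (rule SUP_upper) simp
  finally have "ennreal (1 / B) \<le> hausdorff_measure s K" .
  moreover have "0 < ennreal (1 / B)"
    using B by simp
  ultimately show ?thesis
    by (metis not_le)
qed


section \<open>Non-shy sets of continuous functions\<close>

text \<open>\<open>g\<close> is a sum of ramps \<open>w j\<close> that rise linearly up to
  \<open>\<delta> j\<close> and then stay at height \<open>4 * (1 / 2) ^ j\<close>. If
  \<open>x \<le> \<delta> j\<close> but \<open>x > \<delta> (Suc j)\<close>, ramp
  \<open>Suc j\<close> has reached \<open>2 * (1 / 2) ^ j\<close> and beats the bound on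
  \<open>h x\<close>. If \<open>x \<le> \<delta> j\<close> for all \<open>j\<close>, then
  \<open>h x = 0\<close> and ramp \<open>0\<close> is positive.\<close>

lemma ex_dominating_function:
  fixes \<delta> :: "nat \<Rightarrow> real"
  assumes \<delta>: "\<And>j. \<delta> j > 0"
  obtains g :: "real \<Rightarrow> real" where "continuous_on UNIV g" "g 0 = 0"
    "\<And>h x. 0 < x \<Longrightarrow> x \<le> \<delta> 0 \<Longrightarrow> (\<And>j. x \<le> \<delta> j \<Longrightarrow> \<bar>h x\<bar> \<le> (1 / 2) ^ j) \<Longrightarrow> \<bar>h x\<bar> < g x"
proof -
  define w where "w j x = 4 * ((1 / 2) ^ j * min 1 (\<bar>x\<bar> / \<delta> j))" for j x
  define g where "g x = (\<Sum>j. w j x)" for x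
  have nonneg: "0 \<le> w j x" for j x
    using \<delta>[of j] by (simp add: w_def)
  have le: "norm (w j x) \<le> 4 * (1 / 2) ^ j" for j x
    using \<delta>[of j] nonneg[of j x] by (simp add: w_def mult_left_le)
  have geo: "summable (\<lambda>j. 4 * (1 / 2 :: real) ^ j)"
    by (intro summable_mult summable_geometric) simp
  have sum: "summable (\<lambda>j. w j x)" for x
    by (rule summable_comparison_test'[OF geo le])
  have ge: "w j x \<le> g x" for j x
    using sum_le_suminf[OF sum, of "{j}" x] nonneg by (simp add: g_def)
  show ?thesis
  proof (rule that)
    have "uniform_limit UNIV (\<lambda>n x. \<Sum>j<n. w j x) g sequentially"
      unfolding g_def by (rule Weierstrass_m_test[OF le geo])
    then show "continuous_on UNIV g"
    proof (rule uniform_limit_theorem[rotated])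
      show "\<forall>\<^sub>F n in sequentially. continuous_on UNIV (\<lambda>x. \<Sum>j<n. w j x)"
        unfolding w_def using \<delta>
        by (intro always_eventually allI continuous_intros) (auto simp: less_imp_neq[symmetric])
    qed simp
    show "g 0 = 0"
      by (simp add: g_def w_def)
  next
    fix h :: "real \<Rightarrow> real" and x
    assume x: "0 < x" "x \<le> \<delta> 0" and h: "\<And>j. x \<le> \<delta> j \<Longrightarrow> \<bar>h x\<bar> \<le> (1 / 2) ^ j"
    show "\<bar>h x\<bar> < g x"
    proof (cases "\<forall>j. x \<le> \<delta> j")
      case True
      then have le: "\<bar>h x\<bar> \<le> (1 / 2) ^ j" for j
        using h by simp
      have "(\<lambda>j. (1 / 2 :: real) ^ j) \<longlonglongrightarrow> 0"
        by (intro LIMSEQ_power_zero) simp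
      then have "\<bar>h x\<bar> \<le> 0"
        using le by (intro LIMSEQ_le_const) auto
      moreover have "0 < w 0 x"
        using x \<delta>[of 0] by (simp add: w_def)
      ultimately show ?thesis
        using ge[of 0 x] by linarith
    next
      case False
      then obtain i where i: "\<not> x \<le> \<delta> i"
        by auto
      \<comment> \<open>\<open>\<delta>\<close> need not be monotone: between index
        \<open>0\<close>, where \<open>x\<close> is within the bound, and index \<open>i\<close>,
        where it is not, some step switches.\<close>
      obtain j where j: "x \<le> \<delta> j" "\<not> x \<le> \<delta> (Suc j)"
        using i x(2) inc_induct[of 0 i "\<lambda>k. \<not> x \<le> \<delta> k"] by (metis le0)
      have "w (Suc j) x = 2 * (1 / 2) ^ j"
        using j(2) \<delta>[of "Suc j"] by (simp add: w_def min_absorb1)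
      moreover have "(1 / 2 :: real) ^ j > 0"
        by simp
      ultimately show ?thesis
        using h[OF j(1)] ge[of "Suc j" x] by linarith
    qed
  qed
qed

section \<open>Equicontinuity at a point for Borel probability measures\<close>

text \<open>A violation at one point \<open>x\<close> survives every uniform perturbation smaller
  than half the excess. This makes the sets of the Egorov argument Borel.\<close>

lemma closedin_bounded_oscillation:
  fixes K :: "'a::metric_space set"
  assumes "a \<in> K"
  shows "closedin (mtopology_of (C_metric K))
    {f \<in> carrier (C_group K). \<forall>x\<in>K. dist x a \<le> d \<longrightarrow> \<bar>f x - f a\<bar> \<le> e}" (is "closedin _ ?E")
proof -
  interpret M: Metric_space "mspace (C_metric K)" "mdist (C_metric K)"
    by simp
  have carrier: "carrier (C_group K) = mspace (C_metric K)"
    by (simp add: C_group_def)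
  show ?thesis
    unfolding mtopology_of_def M.closedin_metric
  proof (intro conjI allI impI)
    show "?E \<subseteq> mspace (C_metric K)"
      by (auto simp: carrier)
    fix f assume f: "f \<in> mspace (C_metric K) - ?E"
    then obtain x where x: "x \<in> K" "dist x a \<le> d" "\<bar>f x - f a\<bar> > e"
      by (auto simp: carrier not_le)
    define r where "r = (\<bar>f x - f a\<bar> - e) / 2"
    have "disjnt ?E (M.mball f r)"
      unfolding disjnt_iff
    proof (intro allI notI, elim conjE)
      fix g assume g: "g \<in> ?E" "g \<in> M.mball f r"
      then have fg: "f \<in> carrier (C_group K)" "g \<in> carrier (C_group K)" "mdist (C_metric K) f g < r"
        by (auto simp: carrier)
      have "\<bar>f x - g x\<bar> < r" "\<bar>f a - g a\<bar> < r"
        using mdist_C_metric_ge[OF fg(1,2) x(1)] mdist_C_metric_ge[OF fg(1,2) assms] fg(3) by linarith+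
      moreover have "\<bar>g x - g a\<bar> \<le> e"
        using g(1) x by blast
      ultimately show False
        unfolding r_def by (simp add: field_simps abs_if split: if_splits)
    qed
    moreover have "r > 0"
      using x(3) by (simp add: r_def)
    ultimately show "\<exists>r>0. disjnt ?E (M.mball f r)"
      by blast
  qed
qed

lemma closedin_imp_sets_borel_of:
  assumes "closedin T C"
  shows "C \<in> sets (borel_of T)"
proof -
  have "topspace T - C \<in> sets (borel_of T)"
    using assms unfolding borel_of_def
    by (intro in_measure_of) (auto dest: openin_subset)
  then have "space (borel_of T) - (topspace T - C) \<in> sets (borel_of T)"
    by (rule sets.compl_sets)
  moreover have "space (borel_of T) = topspace T"
    by (simp add: borel_of_def space_measure_of_conv)
  ultimately show ?thesis
    using closedin_subset[OF assms] by (simp add: double_diff)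
qed

text \<open>For fixed \<open>j\<close> the sets \<open>E j m\<close> increase with \<open>m\<close>
  to the whole space, by continuity at \<open>a\<close>. Choosing complements of measure below
  \<open>(1 / 2) ^ (j + 2)\<close> bounds their union by \<open>1 / 2\<close>, so together with a
  null set they cannot exhaust the space. The modulus is fixed before \<open>N\<close>, since the
  translate to be avoided depends on it.\<close>

lemma ex_modulus_not_null:
  fixes K :: "'a::metric_space set"
  assumes K: "compact K" "a \<in> K"
    and \<nu>: "prob_space \<nu>" "sets \<nu> = sets (borel_of (mtopology_of (C_metric K)))"
  obtains \<delta> :: "nat \<Rightarrow> real" where "\<And>j. \<delta> j > 0"
    "\<And>N. N \<in> null_sets \<nu> \<Longrightarrow> \<exists>f\<in>carrier (C_group K) - N.
      \<forall>j. \<forall>x\<in>K. dist x a \<le> \<delta> j \<longrightarrow> \<bar>f x - f a\<bar> \<le> (1 / 2) ^ j"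
proof -
  interpret prob_space \<nu>
    by (rule \<nu>)
  define E where "E j m = {f \<in> carrier (C_group K). \<forall>x\<in>K. dist x a \<le> 1 / real (Suc m) \<longrightarrow>
    \<bar>f x - f a\<bar> \<le> (1 / 2) ^ j}" for j m :: nat
  have space: "space \<nu> = carrier (C_group K)"
    using sets_eq_imp_space_eq[OF \<nu>(2)] by (simp add: borel_of_def space_measure_of_conv C_group_def)
  have E: "E j m \<in> sets \<nu>" for j m
    unfolding \<nu>(2) E_def by (intro closedin_imp_sets_borel_of closedin_bounded_oscillation K(2))
  have "\<exists>m. emeasure \<nu> (space \<nu> - E j m) < ennreal ((1 / 2) ^ (j + 2))" for j
  proof -
    have "decseq (\<lambda>m. space \<nu> - E j m)"
    proof (rule decseq_SucI)
      fix m
      have "1 / real (Suc (Suc m)) \<le> 1 / real (Suc m)"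
        by (intro divide_left_mono) auto
      then show "space \<nu> - E j (Suc m) \<subseteq> space \<nu> - E j m"
        unfolding E_def by (auto dest: order_trans)
    qed
    then have "(\<lambda>m. emeasure \<nu> (space \<nu> - E j m)) \<longlonglongrightarrow> emeasure \<nu> (\<Inter>m. space \<nu> - E j m)"
      using E by (intro Lim_emeasure_decseq) auto
    moreover have "(\<Inter>m. space \<nu> - E j m) = {}"
    proof -
      have "\<exists>m. f \<in> E j m" if f: "f \<in> carrier (C_group K)" for f
      proof -
        have "continuous_on K f"
          using f by (simp add: carrier_C_group[OF K(1)])
        moreover have "(1 / 2 :: real) ^ j > 0"
          by simp
        ultimately obtain d where d: "d > 0" "\<And>x. x \<in> K \<Longrightarrow> dist x a < d \<Longrightarrow> dist (f x) (f a) < (1 / 2) ^ j"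
          using K(2) unfolding continuous_on_iff by blast
        obtain m where "1 / real (Suc m) < d"
          using nat_approx_posE[OF d(1)] by auto
        then have "f \<in> E j m"
          using f d(2) unfolding E_def dist_real_def by (auto intro!: less_imp_le)
        then show ?thesis ..
      qed
      then show ?thesis
        unfolding space by blast
    qed
    ultimately have "(\<lambda>m. emeasure \<nu> (space \<nu> - E j m)) \<longlonglongrightarrow> 0"
      by (simp only: emeasure_empty)
    then have "\<forall>\<^sub>F m in sequentially. emeasure \<nu> (space \<nu> - E j m) < ennreal ((1 / 2) ^ (j + 2))"
      by (rule order_tendstoD) simp
    then show ?thesis
      by (rule eventually_happens'[OF sequentially_bot])
  qed
  then obtain m where m: "\<And>j. emeasure \<nu> (space \<nu> - E j (m j)) < ennreal ((1 / 2) ^ (j + 2))"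
    by metis
  show ?thesis
  proof (rule that[of "\<lambda>j. 1 / real (Suc (m j))"])
    fix N assume N: "N \<in> null_sets \<nu>"
    show "\<exists>f\<in>carrier (C_group K) - N. \<forall>j. \<forall>x\<in>K. dist x a \<le> 1 / real (Suc (m j)) \<longrightarrow>
        \<bar>f x - f a\<bar> \<le> (1 / 2) ^ j"
    proof (rule ccontr)
      assume contr: "\<not> ?thesis"
      let ?D = "\<lambda>j. space \<nu> - E j (m j)"
      have "space \<nu> \<subseteq> N \<union> (\<Union>j. ?D j)"
        using contr unfolding space E_def by blast
      then have "emeasure \<nu> (space \<nu>) \<le> emeasure \<nu> (N \<union> (\<Union>j. ?D j))"
        using N E by (intro emeasure_mono) auto
      also have "\<dots> \<le> emeasure \<nu> N + emeasure \<nu> (\<Union>j. ?D j)"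
        using N E by (intro emeasure_subadditive) auto
      also have "emeasure \<nu> N = 0"
        using N by auto
      also have "emeasure \<nu> (\<Union>j. ?D j) \<le> (\<Sum>j. emeasure \<nu> (?D j))"
        using E by (intro emeasure_subadditive_countably) auto
      also have "\<dots> \<le> (\<Sum>j. ennreal ((1 / 2) ^ (j + 2)))"
        by (intro suminf_le less_imp_le[OF m] summableI)
      also have "\<dots> = ennreal (1 / 2)"
        using sums_mult[OF power_half_series, of "1 / 2"]
        by (intro suminf_ennreal_eq) auto
      finally have "ennreal 1 \<le> ennreal (1 / 2)"
        by (simp only: emeasure_space_1 add_0_left ennreal_1)
      then show False
        by (subst (asm) ennreal_le_iff) auto
    qed
  qed simp
qed

text \<open>The measure determines \<open>\<delta>\<close>, and \<open>\<delta>\<close> determines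
  \<open>g\<close>. The translate of \<open>B\<close> by the inverse of \<open>g\<close> is null, so
  some \<open>f\<close> with modulus \<open>\<delta>\<close> lies outside it; yet the product of
  \<open>f\<close> and \<open>g\<close> lies in \<open>A\<close> and hence in \<open>B\<close>,
  which puts \<open>f\<close> into that translate.\<close>

lemma not_shy_C_group:
  fixes K :: "real set"
  assumes K: "compact K" "a \<in> K"
    and A: "\<And>\<delta> :: nat \<Rightarrow> real. (\<And>j. \<delta> j > 0) \<Longrightarrow> \<exists>g\<in>carrier (C_group K). \<forall>f\<in>carrier (C_group K).
      (\<forall>j. \<forall>x\<in>K. dist x a \<le> \<delta> j \<longrightarrow> \<bar>f x - f a\<bar> \<le> (1 / 2) ^ j) \<longrightarrow> f \<otimes>\<^bsub>C_group K\<^esub> g \<in> A"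
  shows "\<not> shy (C_group K) (mtopology_of (C_metric K)) A"
proof
  interpret comm_group "C_group K"
    using K(1) by (rule comm_group_C_group)
  assume "shy (C_group K) (mtopology_of (C_metric K)) A"
  then obtain B \<nu> where B: "A \<subseteq> B" and \<nu>: "prob_space \<nu>" "sets \<nu> = sets (borel_of (mtopology_of (C_metric K)))"
    and null: "\<And>x. x \<in> carrier (C_group K) \<Longrightarrow> (\<lambda>b. b \<otimes>\<^bsub>C_group K\<^esub> x) ` B \<in> null_sets \<nu>"
    unfolding shy_def by blast
  obtain \<delta> :: "nat \<Rightarrow> real" where \<delta>: "\<And>j. \<delta> j > 0"
    "\<And>N. N \<in> null_sets \<nu> \<Longrightarrow> \<exists>f\<in>carrier (C_group K) - N.
      \<forall>j. \<forall>x\<in>K. dist x a \<le> \<delta> j \<longrightarrow> \<bar>f x - f a\<bar> \<le> (1 / 2) ^ j"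
    using ex_modulus_not_null[OF K \<nu>] by blast
  from A[OF \<delta>(1)] obtain g where g: "g \<in> carrier (C_group K)"
    "\<forall>f\<in>carrier (C_group K). (\<forall>j. \<forall>x\<in>K. dist x a \<le> \<delta> j \<longrightarrow> \<bar>f x - f a\<bar> \<le> (1 / 2) ^ j) \<longrightarrow>
      f \<otimes>\<^bsub>C_group K\<^esub> g \<in> A"
    by (rule bexE)
  from \<delta>(2)[OF null[OF inv_closed[OF g(1)]]]
  obtain f where f: "f \<in> carrier (C_group K) - (\<lambda>b. b \<otimes>\<^bsub>C_group K\<^esub> inv\<^bsub>C_group K\<^esub> g) ` B"
    "\<forall>j. \<forall>x\<in>K. dist x a \<le> \<delta> j \<longrightarrow> \<bar>f x - f a\<bar> \<le> (1 / 2) ^ j"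
    by (rule bexE)
  have f': "f \<in> carrier (C_group K)"
    using f(1) by simp
  have "f = (f \<otimes>\<^bsub>C_group K\<^esub> g) \<otimes>\<^bsub>C_group K\<^esub> inv\<^bsub>C_group K\<^esub> g"
    using f' g(1) by (simp add: m_assoc)
  moreover have "f \<otimes>\<^bsub>C_group K\<^esub> g \<in> B"
    using bspec[OF g(2) f'] f(2) B by (simp only: subset_iff simp_thms)
  ultimately show False
    using f(1) by blast
qed


section \<open>The union of Cantor sets\<close>

text \<open>The values increase from \<open>1 / 4\<close> to the limit \<open>1 / 2\<close>, so the
  dimensions \<open>ln 2 / ln (1 / cantor_ratio n)\<close> stay below \<open>1\<close> and tend to
  \<open>1\<close>.\<close>

definition cantor_ratio :: "nat \<Rightarrow> real" where
  "cantor_ratio n = 1 / 2 - 1 / real (n + 4)"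

text \<open>A Cantor set with scale \<open>c\<close> lies in \<open>{0..2 * c}\<close>; the exponent
  \<open>Suc n\<close> therefore puts the piece into \<open>{0..(1 / 2) ^ n}\<close>.\<close>

definition cantor_piece :: "nat \<Rightarrow> real set" where
  "cantor_piece n = cantor ((1 / 2) ^ Suc n) (cantor_ratio n)"

definition cantor_union :: "real set" where
  "cantor_union = (\<Union>n. cantor_piece n)"

lemma cantor_ratio_bounds: "0 < cantor_ratio n" "cantor_ratio n < 1 / 2"
  by (simp_all add: cantor_ratio_def field_simps)

lemma cantor_ratio_LIMSEQ: "cantor_ratio \<longlonglongrightarrow> 1 / 2"
  unfolding cantor_ratio_def by real_asymp

lemma cantor_piece_subset: "cantor_piece n \<subseteq> {0..(1 / 2) ^ n}"
  using cantor_subset[of "cantor_ratio n" "(1 / 2) ^ Suc n"] cantor_ratio_bounds[of n]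
  by (simp add: cantor_piece_def)

text \<open>A ratio below \<open>1 / 2\<close> makes the similarity dimension less than
  \<open>1\<close>. One \<open>s\<close> serves all subsets of the piece, in particular parts of
  level sets.\<close>

lemma upper_box_dim_subset_cantor_piece:
  obtains s where "s < 1" "\<And>X. X \<subseteq> cantor_piece n \<Longrightarrow> upper_box_dim X \<le> ereal s"
proof (rule that)
  let ?r = "cantor_ratio n"
  note r = cantor_ratio_bounds[of n]
  have "ln 2 < ln (1 / ?r)"
    using r by (subst ln_less_cancel_iff) (auto simp: field_simps)
  then show "ln 2 / ln (1 / ?r) < 1"
    using r by auto
  show "upper_box_dim X \<le> ereal (ln 2 / ln (1 / ?r))" if "X \<subseteq> cantor_piece n" for X
    using that r unfolding cantor_piece_def
    by (intro upper_box_dim_subset_cantor_le[of _ "(1 / 2) ^ Suc n"]) (use power_le_one[of "1 / 2 :: real" "Suc n"] in auto)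
qed

lemma zero_in_cantor_piece: "0 \<in> cantor_piece n"
  by (simp add: cantor_piece_def zero_in_cantor)

lemma zero_in_cantor_union: "0 \<in> cantor_union"
  using zero_in_cantor_piece by (auto simp: cantor_union_def)

lemma cantor_union_away_from_0:
  assumes "0 < d"
  obtains N where "{x \<in> cantor_union. x = 0 \<or> d \<le> x} \<subseteq> (\<Union>n<N. cantor_piece n)"
proof -
  obtain N where N: "(1 / 2) ^ N < d"
    using real_arch_pow_inv[OF assms, of "1 / 2"] by auto
  \<comment> \<open>\<open>Suc N\<close> leaves at least one piece, which contains \<open>0\<close>,
    even when \<open>N = 0\<close>.\<close>
  have "x \<in> (\<Union>n<Suc N. cantor_piece n)" if "x \<in> cantor_union" "x = 0 \<or> d \<le> x" for x
  proof (cases "x = 0")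
    case False
    obtain n where n: "x \<in> cantor_piece n"
      using \<open>x \<in> cantor_union\<close> by (auto simp: cantor_union_def)
    have "n < N"
    proof (rule ccontr)
      assume "\<not> n < N"
      then have "(1 / 2 :: real) ^ n \<le> (1 / 2) ^ N"
        by (intro power_decreasing) auto
      moreover have "x \<le> (1 / 2) ^ n"
        using subsetD[OF cantor_piece_subset n] by simp
      ultimately show False
        using N that(2) False by linarith
    qed
    then show ?thesis
      using n by auto
  qed (use zero_in_cantor_piece in auto)
  then show ?thesis
    by (intro that[of "Suc N"]) blast
qed

text \<open>The infinite union is also an intersection of closed sets: keep the first
  \<open>N\<close> pieces and replace the others by \<open>{0..(1 / 2) ^ N}\<close>. A positive
  point leaves this interval for large \<open>N\<close>, and \<open>0\<close> belongs to every
  piece.\<close>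

lemma compact_cantor_union: "compact cantor_union"
proof -
  have eq: "cantor_union = (\<Inter>N. {0..(1 / 2) ^ N} \<union> (\<Union>n<N. cantor_piece n))"
  proof (intro equalityI subsetI)
    fix x assume "x \<in> cantor_union"
    then obtain n where n: "x \<in> cantor_piece n"
      by (auto simp: cantor_union_def)
    show "x \<in> (\<Inter>N. {0..(1 / 2) ^ N} \<union> (\<Union>n<N. cantor_piece n))"
    proof
      fix N
      show "x \<in> {0..(1 / 2) ^ N} \<union> (\<Union>n<N. cantor_piece n)"
      proof (cases "n < N")
        case False
        then have "{0..(1 / 2 :: real) ^ n} \<subseteq> {0..(1 / 2) ^ N}"
          by (simp add: power_decreasing)
        then show ?thesis
          using subsetD[OF cantor_piece_subset n] by blast
      qed (use n in auto)
    qed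
  next
    fix x assume x: "x \<in> (\<Inter>N. {0..(1 / 2) ^ N} \<union> (\<Union>n<N. cantor_piece n))"
    then have "x \<in> {0..(1 / 2) ^ 0} \<union> (\<Union>n<0. cantor_piece n)"
      by blast
    then have "x \<ge> 0"
      by simp
    show "x \<in> cantor_union"
    proof (cases "x = 0")
      case False
      then obtain N where "(1 / 2) ^ N < x"
        using real_arch_pow_inv[of x "1 / 2"] \<open>x \<ge> 0\<close> by auto
      moreover have "x \<in> {0..(1 / 2) ^ N} \<union> (\<Union>n<N. cantor_piece n)"
        using x by blast
      ultimately show ?thesis
        by (auto simp: cantor_union_def)
    qed (simp add: zero_in_cantor_union)
  qed
  have "cantor_union \<subseteq> {0..1}"
  proof
    fix x assume "x \<in> cantor_union"
    then have "x \<in> {0..(1 / 2) ^ 0} \<union> (\<Union>n<0. cantor_piece n)"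
      unfolding eq by blast
    then show "x \<in> {0..1}"
      by simp
  qed
  then have "bounded cantor_union"
    by (rule bounded_subset[rotated]) simp
  moreover have "closed cantor_union"
    unfolding eq by (intro closed_INT ballI closed_Un closed_UN) (auto simp: cantor_piece_def closed_cantor)
  ultimately show ?thesis
    by (simp add: compact_eq_bounded_closed)
qed

lemma cantor_union_nonneg: "x \<in> cantor_union \<Longrightarrow> 0 \<le> x"
  using subsetD[OF cantor_piece_subset] by (auto simp: cantor_union_def)

section \<open>Dimensions of the union and of its subsets\<close>

lemma packing_dim_cantor_union_le: "packing_dim cantor_union \<le> 1"
proof (rule packing_dim_le_UN)
  show "cantor_union \<subseteq> (\<Union>n. cantor_piece n)"
    by (simp add: cantor_union_def)
  fix n
  obtain s where s: "s < 1" "\<And>X. X \<subseteq> cantor_piece n \<Longrightarrow> upper_box_dim X \<le> ereal s"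
    using upper_box_dim_subset_cantor_piece[of n] by metis
  have "upper_box_dim (cantor_union \<inter> cantor_piece n) \<le> ereal s"
    by (rule s) simp
  also have "\<dots> \<le> 1"
    using s(1) by (simp add: one_ereal_def)
  finally show "upper_box_dim (cantor_union \<inter> cantor_piece n) \<le> 1" .
qed

text \<open>For \<open>s < 1\<close> the limit \<open>(1 / 2) powr s\<close> of
  \<open>cantor_ratio n powr s\<close> exceeds \<open>1 / 2\<close>, so a single piece already has
  nonzero measure in dimension \<open>s\<close>.\<close>

lemma hausdorff_dim_cantor_union_ge: "1 \<le> hausdorff_dim cantor_union"
proof -
  have "1 \<le> s" if s: "0 \<le> s" "hausdorff_measure s cantor_union = 0" for s
  proof (rule ccontr)
    assume "\<not> 1 \<le> s"
    then have "(1 / 2) powr 1 < (1 / 2 :: real) powr s"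
      by (intro powr_less_mono') auto
    then have "1 / 2 < (1 / 2 :: real) powr s"
      by simp
    moreover have "(\<lambda>n. cantor_ratio n powr s) \<longlonglongrightarrow> (1 / 2) powr s"
      by (intro tendsto_intros cantor_ratio_LIMSEQ) simp
    ultimately have "\<forall>\<^sub>F n in sequentially. 1 / 2 < cantor_ratio n powr s"
      by (rule order_tendstoD(1)[rotated])
    then obtain n where n: "1 / 2 < cantor_ratio n powr s"
      using eventually_happens'[OF sequentially_bot] by blast
    have "hausdorff_measure s cantor_union \<noteq> 0"
      using cantor_ratio_bounds[of n] s n
      by (intro hausdorff_measure_ne_0_if_cantor_subset[of "cantor_ratio n" "(1 / 2) ^ Suc n"])
        (auto simp: cantor_union_def cantor_piece_def)
    with s show False
      by simp
  qed
  then show ?thesis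
    unfolding hausdorff_dim_def using zero_in_cantor_union
    by (auto intro!: Inf_greatest simp: one_ereal_def)
qed

text \<open>Finitely many bounds below \<open>1\<close> have a maximum below
  \<open>1\<close>.\<close>

lemma packing_dim_subset_finite_pieces_less:
  assumes "L \<subseteq> (\<Union>n<N. cantor_piece n)"
  shows "packing_dim L < 1"
proof -
  have "\<exists>s. s < 1 \<and> (\<forall>X \<subseteq> cantor_piece n. upper_box_dim X \<le> ereal s)" for n
    using upper_box_dim_subset_cantor_piece[of n] by metis
  then obtain s where s: "\<And>n. s n < 1" "\<And>n X. X \<subseteq> cantor_piece n \<Longrightarrow> upper_box_dim X \<le> ereal (s n)"
    by metis
  \<comment> \<open>The inserted \<open>0\<close> covers the case \<open>N = 0\<close> and dominates
    the value \<open>-1\<close> of the empty sets that fill up the sequence.\<close>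
  define c where "c = Max (insert 0 (s ` {..<N}))"
  have "packing_dim L \<le> ereal c"
  proof (rule packing_dim_le_UN)
    show "L \<subseteq> (\<Union>n. if n < N then cantor_piece n else {})"
      using assms by fastforce
    fix n
    show "upper_box_dim (L \<inter> (if n < N then cantor_piece n else {})) \<le> ereal c"
    proof (cases "n < N")
      case True
      then have "upper_box_dim (L \<inter> cantor_piece n) \<le> ereal (s n)"
        by (intro s) simp
      also have "\<dots> \<le> ereal c"
        unfolding c_def using True by simp
      finally show ?thesis
        using True by simp
    next
      case False
      have "-1 \<le> c"
        unfolding c_def by (rule order_trans[OF _ Max_ge[of _ 0]]) auto
      with False show ?thesis
        by (simp add: upper_box_dim_def one_ereal_def)
    qed
  qed
  also have "ereal c < 1"
    unfolding c_def one_ereal_def using s(1) by simp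
  finally show ?thesis .
qed

section \<open>Level sets of the perturbed functions\<close>

theorem theorem4p21:
  shows "\<exists>K :: real set.
    compact K \<and> hausdorff_dim K = 1 \<and> packing_dim K = 1 \<and>
    \<not> shy (C_group K) (mtopology_of (C_metric K))
        {f \<in> carrier (C_group K). \<forall>y::real.
           hausdorff_dim {x \<in> K. f x = y} \<le> packing_dim {x \<in> K. f x = y} \<and>
           packing_dim {x \<in> K. f x = y} < 1}"
proof (intro exI conjI)
  let ?K = cantor_union
  show K: "compact ?K"
    by (rule compact_cantor_union)
  interpret comm_group "C_group ?K"
    using K by (rule comm_group_C_group)
  show "hausdorff_dim ?K = 1"
    by (rule antisym[OF order_trans[OF hausdorff_dim_le_packing_dim packing_dim_cantor_union_le]
          hausdorff_dim_cantor_union_ge])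
  show "packing_dim ?K = 1"
    by (rule antisym[OF packing_dim_cantor_union_le
          order_trans[OF hausdorff_dim_cantor_union_ge hausdorff_dim_le_packing_dim]])
  show "\<not> shy (C_group ?K) (mtopology_of (C_metric ?K))
        {f \<in> carrier (C_group ?K). \<forall>y::real.
           hausdorff_dim {x \<in> ?K. f x = y} \<le> packing_dim {x \<in> ?K. f x = y} \<and>
           packing_dim {x \<in> ?K. f x = y} < 1}"
  proof (rule not_shy_C_group[OF K zero_in_cantor_union])
    fix \<delta> :: "nat \<Rightarrow> real" assume \<delta>: "\<And>j. \<delta> j > 0"
    obtain g :: "real \<Rightarrow> real" where g: "continuous_on UNIV g" "g 0 = 0"
      "\<And>h x. 0 < x \<Longrightarrow> x \<le> \<delta> 0 \<Longrightarrow> (\<And>j. x \<le> \<delta> j \<Longrightarrow> \<bar>h x\<bar> \<le> (1 / 2) ^ j) \<Longrightarrow> \<bar>h x\<bar> < g x"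
      by (rule ex_dominating_function[of \<delta>]) (use \<delta> in auto)
    have g_in: "restrict g ?K \<in> carrier (C_group ?K)"
      using continuous_on_subset[OF g(1), of ?K]
      by (simp add: carrier_C_group[OF K] cong: continuous_on_cong)
    have fibre: "packing_dim {x \<in> ?K. (f \<otimes>\<^bsub>C_group ?K\<^esub> restrict g ?K) x = y} < 1"
      if f: "f \<in> carrier (C_group ?K)"
        "\<forall>j. \<forall>x\<in>?K. dist x 0 \<le> \<delta> j \<longrightarrow> \<bar>f x - f 0\<bar> \<le> (1 / 2) ^ j" for f y
    proof -
      have cont: "continuous_on ?K (\<lambda>x. f x + g x)"
        using f(1) continuous_on_subset[OF g(1), of ?K]
        by (intro continuous_intros) (auto simp: carrier_C_group[OF K])
      \<comment> \<open>Away from \<open>0\<close> only finitely many pieces matter, so it suffices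
        to find a gap between \<open>0\<close> and the other points of the level set.\<close>
      have "\<exists>d>0. \<forall>x\<in>?K. f x + g x = y \<longrightarrow> x = 0 \<or> d \<le> x"
      proof (cases "f 0 = y")
        case True
        have "f x + g x \<noteq> y" if x: "x \<in> ?K" "0 < x" "x < \<delta> 0" for x
        proof -
          \<comment> \<open>At the height of the value at \<open>0\<close>, the growth of
            \<open>g\<close> beats the increment of \<open>f\<close>, so the sum stays strictly
            above \<open>y\<close>.\<close>
          have "\<bar>f x - f 0\<bar> < g x"
            using x f(2) by (intro g(3)[of x "\<lambda>x. f x - f 0"]) auto
          then show ?thesis
            using True by linarith
        qed
        then show ?thesis
          using \<delta>[of 0] cantor_union_nonneg by (intro exI[of _ "\<delta> 0"]) force
      next
        case False
        then have "\<bar>f 0 - y\<bar> > 0"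
          by simp
        \<comment> \<open>At any other height continuity at \<open>0\<close> suffices.\<close>
        then obtain d where d: "d > 0" "\<And>x. x \<in> ?K \<Longrightarrow> dist x 0 < d \<Longrightarrow>
            dist (f x + g x) (f 0 + g 0) < \<bar>f 0 - y\<bar>"
          using cont zero_in_cantor_union unfolding continuous_on_iff by blast
        have "d \<le> x" if x: "x \<in> ?K" "f x + g x = y" for x
          using d(2)[OF x(1)] x(2) g(2) cantor_union_nonneg[OF x(1)]
          by (force simp: dist_real_def)
        then show ?thesis
          using d(1) by blast
      qed
      then obtain d where d: "d > 0" "\<And>x. x \<in> ?K \<Longrightarrow> f x + g x = y \<Longrightarrow> x = 0 \<or> d \<le> x"
        by blast
      obtain N where N: "{x \<in> ?K. x = 0 \<or> d \<le> x} \<subseteq> (\<Union>n<N. cantor_piece n)"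
        by (rule cantor_union_away_from_0[OF d(1)])
      have "{x \<in> ?K. (f \<otimes>\<^bsub>C_group ?K\<^esub> restrict g ?K) x = y} \<subseteq> {x \<in> ?K. x = 0 \<or> d \<le> x}"
        using d(2) by (auto simp: mult_C_group)
      then show ?thesis
        using N by (intro packing_dim_subset_finite_pieces_less[of _ N]) blast
    qed
    have "f \<otimes>\<^bsub>C_group ?K\<^esub> restrict g ?K \<in> {f \<in> carrier (C_group ?K). \<forall>y::real.
           hausdorff_dim {x \<in> ?K. f x = y} \<le> packing_dim {x \<in> ?K. f x = y} \<and>
           packing_dim {x \<in> ?K. f x = y} < 1}"
      if f: "f \<in> carrier (C_group ?K)"
        "\<forall>j. \<forall>x\<in>?K. dist x 0 \<le> \<delta> j \<longrightarrow> \<bar>f x - f 0\<bar> \<le> (1 / 2) ^ j" for f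
      using m_closed[OF f(1) g_in] fibre[OF f] by (simp add: hausdorff_dim_le_packing_dim)
    then show "\<exists>g\<in>carrier (C_group ?K). \<forall>f\<in>carrier (C_group ?K).
        (\<forall>j. \<forall>x\<in>?K. dist x 0 \<le> \<delta> j \<longrightarrow> \<bar>f x - f 0\<bar> \<le> (1 / 2) ^ j) \<longrightarrow>
        f \<otimes>\<^bsub>C_group ?K\<^esub> g \<in> {f \<in> carrier (C_group ?K). \<forall>y::real.
           hausdorff_dim {x \<in> ?K. f x = y} \<le> packing_dim {x \<in> ?K. f x = y} \<and>
           packing_dim {x \<in> ?K. f x = y} < 1}"
      by (intro bexI[OF _ g_in] ballI impI)
  qed
qed

end
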